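(* Let $\langle R,\sim\rangle$ be the Rado graph. The partial ordering $\langle\mathbb{P}(R),\subset\rangle$ has the 2-localization property.
   Context: The Rado graph is the unique (up to isomorphism) countable graph $\langle R,\sim\rangle$ such that for all finite $K\subseteq H\subseteq R$ there is $v\in R\setminus H$ adjacent to every element of $K$ and to no element of $H\setminus K$. $\mathbb{P}(R)$ is the set of all $A\subseteq R$ such that the induced subgraph on $A$ is isomorphic to $R$, ordered by inclusion. A subtree $T$ of ${}^{<\omega}\omega$ (subset closed under initial segments) is binary iff each element has at most two immediate successors in $T$; $\mathrm{Bt}({}^{<\omega}\omega)$ denotes the set of binary subtrees. A pre-order $\mathbb{P}$ has the 2-localization property iff in every generic extension $V[G]$ of the ground model $V$ by $\mathbb{P}$, for every function $x:\omega\to\omega$ there is $T\in\mathrm{Bt}({}^{<\omega}\omega)\cap V$ with $x\restriction n\in T$ for all $n\in\omega$. *)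

theory Defs
  imports Main "HOL-Library.Countable_Set" "HOL-Library.Sublist"
begin

definition rado_graph :: "'a set \<Rightarrow> ('a \<Rightarrow> 'a \<Rightarrow> bool) \<Rightarrow> bool" where
  "rado_graph R E \<longleftrightarrow>
     countable R \<and>
     (\<forall>x\<in>R. \<not> E x x) \<and>
     (\<forall>x\<in>R. \<forall>y\<in>R. E x y \<longrightarrow> E y x) \<and>
     (\<forall>H K. finite H \<longrightarrow> K \<subseteq> H \<longrightarrow> H \<subseteq> R \<longrightarrow>
        (\<exists>v\<in>R - H. (\<forall>k\<in>K. E v k) \<and> (\<forall>h\<in>H - K. \<not> E v h)))"

definition copies :: "'a set \<Rightarrow> ('a \<Rightarrow> 'a \<Rightarrow> bool) \<Rightarrow> 'a set set" where
  "copies R E =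
     {A. A \<subseteq> R \<and> (\<exists>f. bij_betw f R A \<and> (\<forall>x\<in>R. \<forall>y\<in>R. E x y \<longleftrightarrow> E (f x) (f y)))}"

definition binary_subtree :: "nat list set \<Rightarrow> bool" where
  "binary_subtree T \<longleftrightarrow>
     (\<forall>t\<in>T. \<forall>s. prefix s t \<longrightarrow> s \<in> T) \<and>
     (\<forall>t\<in>T. finite {s\<in>T. \<exists>n. s = t @ [n]} \<and> card {s\<in>T. \<exists>n. s = t @ [n]} \<le> 2)"

text \<open>
  The ground model is the HOL universe, so its generic filters cannot be quantified over; as
  usual, a sentence holding in every generic extension means that every condition forces it.
  The elements of the extension are given by names: a name is a set of pairs of a name and a
  condition, here presented as a partial family of names, each paired with a set of
  conditions. The index type bounds the hereditary size of the names; it contains \<^typ>\<open>nat\<close> so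
  that countable ground-model sets have names, and \<^typ>\<open>'i\<close> is arbitrary.
\<close>

datatype ('i, 'p) pname = PName "nat + 'i \<Rightarrow> (('i, 'p) pname \<times> 'p set) option"

context
  fixes P :: "'p set" and le :: "'p \<Rightarrow> 'p \<Rightarrow> bool"  (infix "\<sqsubseteq>" 50)
begin

primrec entries :: "('i, 'p) pname \<Rightarrow> (('i, 'p) pname \<times> 'p) set" where
  "entries (PName f) = {(\<sigma>, r). \<exists>i A. f i = Some (\<sigma>, A) \<and> r \<in> A \<inter> P}"

definition dense_below :: "('p \<Rightarrow> bool) \<Rightarrow> 'p \<Rightarrow> bool" where
  "dense_below D p \<longleftrightarrow> (\<forall>q\<in>P. q \<sqsubseteq> p \<longrightarrow> (\<exists>q'\<in>P. q' \<sqsubseteq> q \<and> D q'))"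

lemma dense_below_mono [mono]:
  "(\<And>q. D q \<longrightarrow> D' q) \<Longrightarrow> dense_below D p \<longrightarrow> dense_below D' p"
  unfolding dense_below_def by blast

text \<open>
  A sentence of the forcing language is represented by the predicate ``is forced by the
  condition p''. Equality is the usual recursion on names, in which an element \<open>\<pi>\<close> of
  \<open>\<sigma>\<close> is forced into \<open>\<tau>\<close> and conversely; since \<open>entries\<close> is well-founded, this recursion
  has exactly one solution, namely the inductively defined one.
\<close>

inductive forces_eq :: "('i, 'p) pname \<Rightarrow> ('i, 'p) pname \<Rightarrow> 'p \<Rightarrow> bool" where
  "\<lbrakk> \<And>\<pi> r q. \<lbrakk> (\<pi>, r) \<in> entries \<sigma>; q \<in> P; q \<sqsubseteq> p; q \<sqsubseteq> r \<rbrakk> \<Longrightarrow>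
       dense_below (\<lambda>q'. \<exists>\<rho> s. (\<rho>, s) \<in> entries \<tau> \<and> q' \<sqsubseteq> s \<and> forces_eq \<pi> \<rho> q') q;
     \<And>\<rho> s q. \<lbrakk> (\<rho>, s) \<in> entries \<tau>; q \<in> P; q \<sqsubseteq> p; q \<sqsubseteq> s \<rbrakk> \<Longrightarrow>
       dense_below (\<lambda>q'. \<exists>\<pi> r. (\<pi>, r) \<in> entries \<sigma> \<and> q' \<sqsubseteq> r \<and> forces_eq \<pi> \<rho> q') q \<rbrakk>
   \<Longrightarrow> forces_eq \<sigma> \<tau> p"

definition forces_mem :: "('i, 'p) pname \<Rightarrow> ('i, 'p) pname \<Rightarrow> 'p \<Rightarrow> bool" where
  "forces_mem \<pi> \<tau> = dense_below (\<lambda>q. \<exists>\<rho> s. (\<rho>, s) \<in> entries \<tau> \<and> q \<sqsubseteq> s \<and> forces_eq \<pi> \<rho> q)"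

definition forces_not :: "('p \<Rightarrow> bool) \<Rightarrow> 'p \<Rightarrow> bool" where
  "forces_not \<phi> p \<longleftrightarrow> (\<forall>q\<in>P. q \<sqsubseteq> p \<longrightarrow> \<not> \<phi> q)"

definition forces_and :: "('p \<Rightarrow> bool) \<Rightarrow> ('p \<Rightarrow> bool) \<Rightarrow> 'p \<Rightarrow> bool" where
  "forces_and \<phi> \<psi> p \<longleftrightarrow> \<phi> p \<and> \<psi> p"

definition forces_imp :: "('p \<Rightarrow> bool) \<Rightarrow> ('p \<Rightarrow> bool) \<Rightarrow> 'p \<Rightarrow> bool" where
  "forces_imp \<phi> \<psi> = forces_not (forces_and \<phi> (forces_not \<psi>))"

definition forces_iff :: "('p \<Rightarrow> bool) \<Rightarrow> ('p \<Rightarrow> bool) \<Rightarrow> 'p \<Rightarrow> bool" where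
  "forces_iff \<phi> \<psi> = forces_and (forces_imp \<phi> \<psi>) (forces_imp \<psi> \<phi>)"

text \<open>
  The variable of a quantifier ranges over the extension if \<^typ>\<open>'b\<close> is a type of names; if
  \<^typ>\<open>'b\<close> is any other type, it ranges over a set in the ground model.
\<close>

definition forces_all :: "('b \<Rightarrow> 'p \<Rightarrow> bool) \<Rightarrow> 'p \<Rightarrow> bool" where
  "forces_all \<phi> p \<longleftrightarrow> (\<forall>x. \<phi> x p)"

definition forces_ex :: "('b \<Rightarrow> 'p \<Rightarrow> bool) \<Rightarrow> 'p \<Rightarrow> bool" where
  "forces_ex \<phi> = dense_below (\<lambda>q. \<exists>x. \<phi> x q)"

definition forces_ball ::
    "('i, 'p) pname \<Rightarrow> (('i, 'p) pname \<Rightarrow> 'p \<Rightarrow> bool) \<Rightarrow> 'p \<Rightarrow> bool" where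
  "forces_ball \<tau> \<phi> = forces_all (\<lambda>\<sigma>. forces_imp (forces_mem \<sigma> \<tau>) (\<phi> \<sigma>))"

definition forces_bex ::
    "('i, 'p) pname \<Rightarrow> (('i, 'p) pname \<Rightarrow> 'p \<Rightarrow> bool) \<Rightarrow> 'p \<Rightarrow> bool" where
  "forces_bex \<tau> \<phi> = forces_ex (\<lambda>\<sigma>. forces_and (forces_mem \<sigma> \<tau>) (\<phi> \<sigma>))"

text \<open>
  The name whose entries are all pairs of a member of \<open>S\<close> and a condition, for countable \<open>S\<close>.
\<close>

definition set_name :: "('i, 'p) pname set \<Rightarrow> ('i, 'p) pname" where
  "set_name S =
     PName (\<lambda>i. case i of
        Inl k \<Rightarrow> if S = {} then None else Some (from_nat_into S k, UNIV)
      | Inr _ \<Rightarrow> None)"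

lemma entries_set_name:
  assumes "countable S"
  shows "entries (set_name S) = S \<times> P"
proof (cases "S = {}")
  case False
  have "(\<sigma>, r) \<in> entries (set_name S) \<longleftrightarrow> \<sigma> \<in> range (from_nat_into S) \<and> r \<in> P" for \<sigma> r
    using False unfolding set_name_def by (simp add: split_sum_ex image_iff eq_commute)
  then show ?thesis
    using False assms by (auto simp: range_from_nat_into)
qed (auto simp: set_name_def split: sum.splits)

text \<open>Kuratowski pairs, von Neumann numerals, and sequences as functions on a numeral.\<close>

definition pair_name :: "('i, 'p) pname \<Rightarrow> ('i, 'p) pname \<Rightarrow> ('i, 'p) pname" where
  "pair_name \<sigma> \<tau> = set_name {set_name {\<sigma>}, set_name {\<sigma>, \<tau>}}"

fun nat_name :: "nat \<Rightarrow> ('i, 'p) pname" where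
  "nat_name n = set_name (nat_name ` {..<n})"

declare nat_name.simps [simp del]

definition omega_name :: "('i, 'p) pname" where
  "omega_name = set_name (range nat_name)"

definition seq_name :: "nat list \<Rightarrow> ('i, 'p) pname" where
  "seq_name s = set_name ((\<lambda>k. pair_name (nat_name k) (nat_name (s ! k))) ` {..<length s})"

definition tree_name :: "nat list set \<Rightarrow> ('i, 'p) pname" where
  "tree_name T = set_name (seq_name ` T)"

text \<open>The sentence that \<open>x\<close> is a function from \<open>\<omega>\<close> to \<open>\<omega>\<close>.\<close>

definition forces_real :: "('i, 'p) pname \<Rightarrow> 'p \<Rightarrow> bool" where
  "forces_real x =
     forces_and
       (forces_ball x (\<lambda>z. forces_bex omega_name (\<lambda>n. forces_bex omega_name (\<lambda>m.
          forces_eq z (pair_name n m)))))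
       (forces_ball omega_name (\<lambda>n. forces_bex omega_name (\<lambda>m.
          forces_and (forces_mem (pair_name n m) x)
            (forces_ball omega_name (\<lambda>m'.
               forces_imp (forces_mem (pair_name n m') x) (forces_eq m' m))))))"

text \<open>The sentence that \<open>s\<close> is the restriction of \<open>x\<close> to the natural number \<open>n\<close>.\<close>

definition forces_restrict ::
    "('i, 'p) pname \<Rightarrow> ('i, 'p) pname \<Rightarrow> ('i, 'p) pname \<Rightarrow> 'p \<Rightarrow> bool" where
  "forces_restrict s x n =
     forces_all (\<lambda>z. forces_iff (forces_mem z s)
       (forces_and (forces_mem z x)
          (forces_bex n (\<lambda>k. forces_bex omega_name (\<lambda>m. forces_eq z (pair_name k m))))))"

text \<open>The tree is quantified over the ground model, the function over the extension.\<close>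

definition two_localization :: "'i itself \<Rightarrow> bool" where
  "two_localization _ \<longleftrightarrow>
     (\<forall>p\<in>P. forces_all (\<lambda>x :: ('i, 'p) pname. forces_imp (forces_real x)
        (forces_ex (\<lambda>T q. binary_subtree T \<and>
           forces_ball omega_name (\<lambda>n. forces_bex (tree_name T) (\<lambda>s.
             forces_restrict s x n)) q))) p)"

end

end

theory Submission imports Defs begin

text \<open>
  For a finite subset \<open>F\<close> of a copy \<open>A\<close>, the vertices of \<open>A - F\<close> split into finitely many copies, one
  for each adjacency type over \<open>F\<close>, and every subcopy of \<open>A\<close> has a subcopy inside one of them. The
  types therefore play the role of the nodes of a perfect tree in Sacks forcing. A first fusion
  shrinks a condition to a copy \<open>A\<close> on which each value \<open>x(n)\<close> is decided by the type over a finite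
  subset of \<open>A\<close>; what makes it possible is that \<open>A\<close> contains, for each type over \<open>F\<close>, a copy of
  the whole of \<open>A\<close>, such that these copies are twins of each other, so that shrinking one of them
  does not destroy the adjacencies needed between different types. Then \<open>x\<close> is the value at the
  generic type of a continuous function on the sets of vertices. If this function is constant on a
  basic open set, one branch suffices. Otherwise, a second fusion selects a subcopy whose types branch
  in two at each step, with pairwise distinct initial segments of the values of the function, and
  these initial segments form the binary tree.
\<close>

section \<open>Rado graphs\<close>

text \<open>The vertices of adjacency type \<open>Z\<close> over \<open>G\<close>. Only the trace of
  \<open>Z\<close> on \<open>G\<close> matters; leaving \<open>Z\<close> unrestricted lets one set
  serve as a type over every finite set at once.\<close>

definition piece :: "('a \<Rightarrow> 'a \<Rightarrow> bool) \<Rightarrow> 'a set \<Rightarrow> 'a set \<Rightarrow> 'a set \<Rightarrow> 'a set" where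
  "piece E A G Z = {v \<in> A - G. \<forall>g\<in>G. E v g \<longleftrightarrow> g \<in> Z}"

lemma piece_subset: "piece E A G Z \<subseteq> A"
  by (auto simp: piece_def)

lemma piece_mono: "A' \<subseteq> A \<Longrightarrow> G \<subseteq> G' \<Longrightarrow> Z' \<inter> G = Z \<inter> G \<Longrightarrow> piece E A' G' Z' \<subseteq> piece E A G Z"
  by (auto simp: piece_def)

lemma rado_graph_iff_piece:
  "rado_graph A E \<longleftrightarrow> countable A \<and> (\<forall>x\<in>A. \<not> E x x) \<and> (\<forall>x\<in>A. \<forall>y\<in>A. E x y \<longrightarrow> E y x) \<and>
     (\<forall>H Z. finite H \<longrightarrow> H \<subseteq> A \<longrightarrow> piece E A H Z \<noteq> {})"
proof -
  have "(\<forall>H K. finite H \<longrightarrow> K \<subseteq> H \<longrightarrow> H \<subseteq> A \<longrightarrow>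
        (\<exists>v\<in>A - H. (\<forall>k\<in>K. E v k) \<and> (\<forall>h\<in>H - K. \<not> E v h))) \<longleftrightarrow>
     (\<forall>H Z. finite H \<longrightarrow> H \<subseteq> A \<longrightarrow> piece E A H Z \<noteq> {})" (is "?l \<longleftrightarrow> ?r")
  proof
    assume ?l
    show ?r
    proof (intro allI impI)
      fix H Z assume "finite H" "H \<subseteq> A"
      with \<open>?l\<close>[rule_format, of H "Z \<inter> H"] show "piece E A H Z \<noteq> {}"
        by (auto simp: piece_def)
    qed
  next
    assume ?r
    show ?l
    proof (intro allI impI)
      fix H K assume H: "finite H" "K \<subseteq> H" "H \<subseteq> A"
      with \<open>?r\<close> obtain v where "v \<in> piece E A H K" by blast
      with H show "\<exists>v\<in>A - H. (\<forall>k\<in>K. E v k) \<and> (\<forall>h\<in>H - K. \<not> E v h)"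
        unfolding piece_def by blast
    qed
  qed
  then show ?thesis unfolding rado_graph_def by simp
qed

lemma rado_sym: "rado_graph A E \<Longrightarrow> x \<in> A \<Longrightarrow> y \<in> A \<Longrightarrow> E x y \<longleftrightarrow> E y x"
  unfolding rado_graph_def by blast

lemma rado_irrefl: "rado_graph A E \<Longrightarrow> x \<in> A \<Longrightarrow> \<not> E x x"
  unfolding rado_graph_def by blast

lemma rado_countable: "rado_graph A E \<Longrightarrow> countable A"
  unfolding rado_graph_def by blast

lemma rado_piece_nonempty:
  "rado_graph A E \<Longrightarrow> finite G \<Longrightarrow> G \<subseteq> A \<Longrightarrow> piece E A G Z \<noteq> {}"
  unfolding rado_graph_iff_piece by blast

lemma rado_subsetI:
  assumes "rado_graph A E" "B \<subseteq> A"
    and "\<And>H Z. finite H \<Longrightarrow> H \<subseteq> B \<Longrightarrow> piece E B H Z \<noteq> {}"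
  shows "rado_graph B E"
  using assms unfolding rado_graph_iff_piece by (meson countable_subset subsetD)

text \<open>A demand on a finite subset \<open>H\<close> of the piece, joined with the demand that
  defines the piece, is a single demand on \<open>H \<union> G\<close> in \<open>A\<close>.\<close>

lemma rado_piece:
  assumes A: "rado_graph A E" and G: "finite G" "G \<subseteq> A"
  shows "rado_graph (piece E A G Z) E"
proof (rule rado_subsetI[OF A piece_subset])
  fix H Y assume H: "finite H" "H \<subseteq> piece E A G Z"
  then have "piece E A (H \<union> G) (Y \<inter> H \<union> Z \<inter> G) \<noteq> {}"
    using piece_subset[of E A G Z] by (intro rado_piece_nonempty[OF A]) (auto simp: G)
  then show "piece E (piece E A G Z) H Y \<noteq> {}"
    using H unfolding piece_def by auto
qed

section \<open>Indivisibility and homogeneous subcopies\<close>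

lemma rado_not_singleton: "\<not> rado_graph B E" if "B \<subseteq> {x}"
proof
  assume B: "rado_graph B E"
  have "piece E B B UNIV \<noteq> {}"
    using that by (intro rado_piece_nonempty[OF B]) (auto intro: finite_subset)
  then show False by (auto simp: piece_def)
qed

lemma rado_infinite: assumes "rado_graph A E" shows "infinite A"
  using rado_piece_nonempty[OF assms, of A] by (auto simp: piece_def)

text \<open>If \<open>A \<inter> X\<close> fails the extension property, the piece of
  \<open>A\<close> for the failing demand avoids \<open>X\<close>; it lies in \<open>Y\<close> and
  is itself a copy.\<close>

lemma rado_indivisible:
  assumes A: "rado_graph A E" and "A \<subseteq> X \<union> Y"
  obtains B where "rado_graph B E" "B \<subseteq> A" "B \<subseteq> X \<or> B \<subseteq> Y"
proof (cases "rado_graph (A \<inter> X) E")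
  case True
  then show ?thesis using that by blast
next
  case False
  then obtain H Z where H: "finite H" "H \<subseteq> A \<inter> X" "piece E (A \<inter> X) H Z = {}"
    using rado_subsetI[OF A, of "A \<inter> X"] by blast
  then have "piece E A H Z \<subseteq> Y" using \<open>A \<subseteq> X \<union> Y\<close> by (auto simp: piece_def)
  with H show ?thesis
    using that[of "piece E A H Z"] rado_piece[OF A, of H Z] piece_subset[of E A H Z] by blast
qed

text \<open>Each \<open>g\<close> in \<open>G\<close> takes two applications of indivisibility: one
  drops \<open>g\<close> itself, the other settles adjacency to \<open>g\<close>.\<close>

lemma rado_homogeneous:
  assumes A: "rado_graph A E" and G: "finite G"
  shows "\<exists>B Z. rado_graph B E \<and> B \<subseteq> piece E A G Z"
  using G
proof (induction G)
  case empty
  have "A \<subseteq> piece E A {} {}" by (simp add: piece_def)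
  with A show ?case by blast
next
  case (insert g G)
  then obtain B Z where B: "rado_graph B E" "B \<subseteq> piece E A G Z" by blast
  obtain C where C: "rado_graph C E" "C \<subseteq> B" "C \<subseteq> {g} \<or> C \<subseteq> B - {g}"
    by (rule rado_indivisible[OF B(1), of "{g}" "B - {g}"]) auto
  with rado_not_singleton[of C g E] have "C \<subseteq> B - {g}" by blast
  obtain D where D: "rado_graph D E" "D \<subseteq> C" "D \<subseteq> {v. E v g} \<or> D \<subseteq> {v. \<not> E v g}"
    by (rule rado_indivisible[OF C(1), of "{v. E v g}" "{v. \<not> E v g}"]) auto
  have "D \<subseteq> piece E A (insert g G) (if D \<subseteq> {v. E v g} then insert g Z else Z - {g})"
    using insert.hyps(2) B(2) \<open>C \<subseteq> B - {g}\<close> D(2,3) unfolding piece_def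
    by (auto split: if_splits)
  with D(1) show ?case by blast
qed

text \<open>The second component of \<open>prod_decode\<close> is discarded, which produces the
  repetitions. They allow a fusion to meet a demand after all vertices mentioned in it have been
  added.\<close>

lemma enumerate_finite_subsets:
  assumes "countable R"
  obtains e :: "nat \<Rightarrow> 'a set" where "\<And>K m. finite K \<Longrightarrow> K \<subseteq> R \<Longrightarrow> \<exists>n\<ge>m. e n = K"
proof -
  let ?S = "{K. K \<subseteq> R \<and> finite K}"
  have c: "countable ?S" using countable_Collect_finite_subset[OF assms] by (simp add: conj_commute)
  define e where "e n = from_nat_into ?S (fst (prod_decode n))" for n
  show ?thesis
  proof
    fix K m assume "finite K" "K \<subseteq> R"
    then have "e (prod_encode (to_nat_on ?S K, m)) = K" using c by (simp add: e_def)
    then show "\<exists>n\<ge>m. e n = K" using le_prod_encode_2 by blast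
  qed
qed

text \<open>The limit step of both fusions. A demand \<open>Z\<close> on a finite \<open>H\<close>
  is met by the vertex added at a late stage \<open>n\<close> with \<open>H \<subseteq> F n\<close>
  and \<open>e n = Z \<inter> H\<close>, since within \<open>F n\<close> this vertex is adjacent
  exactly to the elements of \<open>e n\<close>.\<close>

lemma rado_Union:
  fixes F :: "nat \<Rightarrow> 'a set"
  assumes A: "rado_graph A E"
    and e: "\<And>K m. finite K \<Longrightarrow> K \<subseteq> A \<Longrightarrow> \<exists>n\<ge>m. e n = K"
    and F: "\<And>n. F n \<subseteq> A"
    and step: "\<And>n. \<exists>v\<in>piece E A (F n) (e n). F (Suc n) = insert v (F n)"
  shows "rado_graph (\<Union>n. F n) E"
proof (rule rado_subsetI[OF A])
  have F_mono: "F m \<subseteq> F n" if "m \<le> n" for m n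
    using _ that by (rule lift_Suc_mono_le) (use step in blast)
  fix H Z assume H: "finite H" "H \<subseteq> (\<Union>n. F n)"
  then have "\<exists>m. H \<subseteq> F m"
  proof (induction H)
    case (insert x H)
    then obtain m k where "H \<subseteq> F m" "x \<in> F k" by auto
    then have "insert x H \<subseteq> F (max m k)"
      using F_mono[of m "max m k"] F_mono[of k "max m k"] by auto
    then show ?case ..
  qed simp
  then obtain m where m: "H \<subseteq> F m" ..
  obtain n where n: "n \<ge> m" "e n = Z \<inter> H"
    using e[of "Z \<inter> H" m] H m F[of m] by auto
  obtain v where v: "v \<in> piece E A (F n) (e n)" "F (Suc n) = insert v (F n)"
    using step by blast
  have "H \<subseteq> F n" using m F_mono[OF n(1)] by blast
  then have "v \<in> piece E (\<Union>n. F n) H Z"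
    using v n(2) unfolding piece_def by blast
  then show "piece E (\<Union>n. F n) H Z \<noteq> {}" by blast
qed (use F in blast)

lemma rado_image:
  assumes A: "rado_graph A E" and inj: "inj_on f A"
    and E: "\<And>x y. x \<in> A \<Longrightarrow> y \<in> A \<Longrightarrow> E' (f x) (f y) \<longleftrightarrow> E x y"
  shows "rado_graph (f ` A) E'"
  unfolding rado_graph_iff_piece
proof (intro conjI allI impI)
  show "countable (f ` A)" using rado_countable[OF A] by simp
  show "\<forall>x\<in>f ` A. \<not> E' x x" using E rado_irrefl[OF A] by auto
  show "\<forall>x\<in>f ` A. \<forall>y\<in>f ` A. E' x y \<longrightarrow> E' y x" using E rado_sym[OF A] by auto
  fix H Z assume H: "finite H" "H \<subseteq> f ` A"
  then obtain K where K: "K \<subseteq> A" "finite K" "H = f ` K" by (meson finite_subset_image)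
  obtain v where v: "v \<in> piece E A K (f -` Z)" using rado_piece_nonempty[OF A K(2,1)] by blast
  then have "v \<in> A" "v \<notin> K" by (auto simp: piece_def)
  then have "f v \<notin> H" using inj_on_image_mem_iff[OF inj _ K(1)] K(3) by blast
  moreover have "E' (f v) (f k) \<longleftrightarrow> f k \<in> Z" if "k \<in> K" for k
    using v E[OF \<open>v \<in> A\<close>, of k] K(1) that by (auto simp: piece_def)
  ultimately have "f v \<in> piece E' (f ` A) H Z"
    using \<open>v \<in> A\<close> K(3) by (simp add: piece_def)
  then show "piece E' (f ` A) H Z \<noteq> {}" by blast
qed

section \<open>Back-and-forth and the uniqueness of the Rado graph\<close>

definition partial_iso ::
    "'a set \<Rightarrow> ('a \<Rightarrow> 'a \<Rightarrow> bool) \<Rightarrow> 'b set \<Rightarrow> ('b \<Rightarrow> 'b \<Rightarrow> bool) \<Rightarrow> ('a \<times> 'b) set \<Rightarrow> bool" where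
  "partial_iso A E B E' S \<longleftrightarrow> S \<subseteq> A \<times> B \<and>
    (\<forall>x y x' y'. (x, y) \<in> S \<longrightarrow> (x', y') \<in> S \<longrightarrow> (x = x' \<longleftrightarrow> y = y') \<and> (E x x' \<longleftrightarrow> E' y y'))"

lemma partial_isoD:
  assumes "partial_iso A E B E' S" "(x, y) \<in> S" "(x', y') \<in> S"
  shows "x = x' \<longleftrightarrow> y = y'" "E x x' \<longleftrightarrow> E' y y'"
  using assms unfolding partial_iso_def by blast+

lemma partial_iso_subset: "partial_iso A E B E' S \<Longrightarrow> S \<subseteq> A \<times> B"
  unfolding partial_iso_def by blast

lemma partial_iso_converse: "partial_iso A E B E' S \<Longrightarrow> partial_iso B E' A E (S\<inverse>)"
  unfolding partial_iso_def
proof (intro conjI allI impI)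
  assume S: "S \<subseteq> A \<times> B \<and> (\<forall>x y x' y'. (x, y) \<in> S \<longrightarrow> (x', y') \<in> S \<longrightarrow>
    (x = x' \<longleftrightarrow> y = y') \<and> (E x x' \<longleftrightarrow> E' y y'))"
  then show "S\<inverse> \<subseteq> B \<times> A" by blast
  fix y x y' x' assume "(y, x) \<in> S\<inverse>" "(y', x') \<in> S\<inverse>"
  then have "(x = x' \<longleftrightarrow> y = y') \<and> (E x x' \<longleftrightarrow> E' y y')" using S by simp
  then show "y = y' \<longleftrightarrow> x = x'" "E' y y' \<longleftrightarrow> E x x'" by auto
qed

text \<open>The new value \<open>b\<close> is chosen to realize over the range of \<open>S\<close>
  the type that \<open>a\<close> has over the domain.\<close>

lemma partial_iso_extend:
  assumes A: "rado_graph A E" and B: "rado_graph B E'"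
    and S: "finite S" "partial_iso A E B E' S" and a: "a \<in> A"
  obtains b where "partial_iso A E B E' (insert (a, b) S)"
proof (cases "a \<in> fst ` S")
  case True
  then obtain b where "(a, b) \<in> S" by force
  with S that[of b] show ?thesis by (simp add: insert_absorb)
next
  case False
  note sub = partial_iso_subset[OF S(2)]
  then have ran: "snd ` S \<subseteq> B" by force
  obtain b where b: "b \<in> piece E' B (snd ` S) {y. \<exists>x. (x, y) \<in> S \<and> E a x}"
    using rado_piece_nonempty[OF B _ ran] S(1) by blast
  then have "b \<in> B" by (simp add: piece_def)
  have new: "b \<noteq> y \<and> a \<noteq> x \<and> (E' b y \<longleftrightarrow> E a x) \<and> (E' y b \<longleftrightarrow> E x a)" if "(x, y) \<in> S" for x y
  proof -
    have "b \<noteq> y" "E' b y \<longleftrightarrow> (\<exists>x. (x, y) \<in> S \<and> E a x)"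
      using b that unfolding piece_def by force+
    moreover have "(\<exists>x. (x, y) \<in> S \<and> E a x) \<longleftrightarrow> E a x"
      using partial_isoD(1)[OF S(2)] that by blast
    moreover have "a \<noteq> x" using False that by force
    ultimately show ?thesis
      using rado_sym[OF A, of a x] rado_sym[OF B, of b y] that sub a \<open>b \<in> B\<close> by auto
  qed
  have "partial_iso A E B E' (insert (a, b) S)"
    unfolding partial_iso_def
  proof
    show "insert (a, b) S \<subseteq> A \<times> B" using sub a \<open>b \<in> B\<close> by blast
    show "\<forall>x y x' y'. (x, y) \<in> insert (a, b) S \<longrightarrow> (x', y') \<in> insert (a, b) S \<longrightarrow>
        (x = x' \<longleftrightarrow> y = y') \<and> (E x x' \<longleftrightarrow> E' y y')"
    proof (intro allI impI)
      fix x y x' y' assume "(x, y) \<in> insert (a, b) S" "(x', y') \<in> insert (a, b) S"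
      then show "(x = x' \<longleftrightarrow> y = y') \<and> (E x x' \<longleftrightarrow> E' y y')"
        using partial_isoD[OF S(2), of x y x' y'] new[of x y] new[of x' y']
          rado_irrefl[OF A a] rado_irrefl[OF B \<open>b \<in> B\<close>] by auto
    qed
  qed
  then show ?thesis by (rule that)
qed

lemma rado_unique:
  assumes A: "rado_graph A E" and B: "rado_graph B E'"
  obtains f where "bij_betw f A B" "\<And>x y. x \<in> A \<Longrightarrow> y \<in> A \<Longrightarrow> E x y \<longleftrightarrow> E' (f x) (f y)"
proof -
  let ?iso = "partial_iso A E B E'"
  have "\<exists>S. \<forall>n. (finite (S n) \<and> ?iso (S n)) \<and>
      (S n \<subseteq> S (Suc n) \<and> from_nat_into A n \<in> fst ` S (Suc n) \<and> from_nat_into B n \<in> snd ` S (Suc n))"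
  proof (rule dependent_nat_choice)
    show "\<exists>S. finite S \<and> ?iso S" by (rule exI[of _ "{}"]) (simp add: partial_iso_def)
    fix S n assume S: "finite S \<and> ?iso S"
    let ?a = "from_nat_into A n" and ?b = "from_nat_into B n"
    have a: "?a \<in> A" and b: "?b \<in> B"
      using rado_infinite[OF A] rado_infinite[OF B] by (metis finite.emptyI from_nat_into)+
    obtain y where y: "?iso (insert (?a, y) S)"
      using partial_iso_extend[OF A B _ _ a] S by blast
    \<comment> \<open>The back half of the step is the forth half for the converse relation.\<close>
    obtain x where x: "partial_iso B E' A E (insert (?b, x) ((insert (?a, y) S)\<inverse>))"
      using partial_iso_extend[OF B A _ partial_iso_converse[OF y] b] S by auto
    have "(insert (?b, x) ((insert (?a, y) S)\<inverse>))\<inverse> = insert (x, ?b) (insert (?a, y) S)" by auto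
    then have "?iso (insert (x, ?b) (insert (?a, y) S))"
      using partial_iso_converse[OF x] by simp
    then show "\<exists>S'. (finite S' \<and> ?iso S') \<and> (S \<subseteq> S' \<and> ?a \<in> fst ` S' \<and> ?b \<in> snd ` S')"
      using S by (intro exI[of _ "insert (x, ?b) (insert (?a, y) S)"]) auto
  qed
  then obtain S where S: "\<And>n. ?iso (S n)" "\<And>n. S n \<subseteq> S (Suc n)"
      "\<And>n. from_nat_into A n \<in> fst ` S (Suc n)" "\<And>n. from_nat_into B n \<in> snd ` S (Suc n)" by blast
  define U where "U = (\<Union>n. S n)"
  have S_mono: "S m \<subseteq> S n" if "m \<le> n" for m n
    using S(2) that by (rule lift_Suc_mono_le)
  have U: "(x = x' \<longleftrightarrow> y = y') \<and> (E x x' \<longleftrightarrow> E' y y')" if "(x, y) \<in> U" "(x', y') \<in> U" for x y x' y'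
  proof -
    from that obtain m n where "(x, y) \<in> S m" "(x', y') \<in> S n" unfolding U_def by blast
    then have "(x, y) \<in> S (max m n)" "(x', y') \<in> S (max m n)"
      using S_mono[of m "max m n"] S_mono[of n "max m n"] by auto
    then show ?thesis using partial_isoD[OF S(1)] by blast
  qed
  have sub: "U \<subseteq> A \<times> B" using partial_iso_subset[OF S(1)] unfolding U_def by blast
  have dom: "\<exists>y. (x, y) \<in> U" if "x \<in> A" for x
    using S(3)[of "to_nat_on A x"] rado_countable[OF A] that unfolding U_def by force
  have ran: "\<exists>x. (x, y) \<in> U" if "y \<in> B" for y
    using S(4)[of "to_nat_on B y"] rado_countable[OF B] that unfolding U_def by force
  from dom obtain f where f: "\<And>x. x \<in> A \<Longrightarrow> (x, f x) \<in> U" by metis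
  show ?thesis
  proof
    show "bij_betw f A B" unfolding bij_betw_def
    proof (intro conjI equalityI subsetI inj_onI)
      fix x y assume "x \<in> A" "y \<in> A" "f x = f y"
      then show "x = y" using U[OF f f] by blast
    next
      fix y assume "y \<in> f ` A"
      then show "y \<in> B" using f sub by blast
    next
      fix y assume "y \<in> B"
      then obtain x where x: "(x, y) \<in> U" using ran by blast
      then have "x \<in> A" using sub by blast
      with U[OF x f] show "y \<in> f ` A" by blast
    qed
    fix x y assume "x \<in> A" "y \<in> A"
    then show "E x y \<longleftrightarrow> E' (f x) (f y)" using U[OF f f] by blast
  qed
qed

text \<open>An isomorphism carries the extension property to its image, and conversely uniqueness
  supplies the isomorphism. Conditions can thus be handled without mentioning isomorphisms.\<close>

lemma copies_eq:
  assumes R: "rado_graph R E"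
  shows "copies R E = {A. A \<subseteq> R \<and> rado_graph A E}"
proof (intro set_eqI iffI; clarify)
  fix A assume "A \<in> copies R E"
  then obtain f where A: "A \<subseteq> R" "bij_betw f R A" "\<forall>x\<in>R. \<forall>y\<in>R. E x y \<longleftrightarrow> E (f x) (f y)"
    unfolding copies_def by blast
  then have "rado_graph (f ` R) E"
    by (intro rado_image[OF R]) (auto simp: bij_betw_def)
  with A show "A \<subseteq> R \<and> rado_graph A E" by (simp add: bij_betw_def)
next
  fix A assume A: "A \<subseteq> R" "rado_graph A E"
  obtain f where "bij_betw f R A" "\<And>x y. x \<in> R \<Longrightarrow> y \<in> R \<Longrightarrow> E x y \<longleftrightarrow> E (f x) (f y)"
    using rado_unique[OF R A(2)] by blast
  with A show "A \<in> copies R E" unfolding copies_def by blast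
qed

section \<open>Shrinking the pieces of a copy\<close>

text \<open>The vertices are chosen along an enumeration of \<open>Pow F \<times> A\<close>, the
  extension property granting each one its type over \<open>F\<close> and its adjacencies to the
  earlier ones. Since these adjacencies ignore the type, the vertices \<open>g L a\<close> with the
  same index \<open>a\<close> are twins, and an index can be realized in any piece without affecting
  the others.\<close>

lemma rado_twins:
  assumes A: "rado_graph A E" and F: "finite F" "F \<subseteq> A"
  obtains g where "\<And>L a. L \<subseteq> F \<Longrightarrow> a \<in> A \<Longrightarrow> g L a \<in> piece E A F L"
    "\<And>L a L' a'. L \<subseteq> F \<Longrightarrow> a \<in> A \<Longrightarrow> L' \<subseteq> F \<Longrightarrow> a' \<in> A \<Longrightarrow> g L a = g L' a' \<Longrightarrow> L = L' \<and> a = a'"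
    "\<And>L a L' a'. L \<subseteq> F \<Longrightarrow> a \<in> A \<Longrightarrow> L' \<subseteq> F \<Longrightarrow> a' \<in> A \<Longrightarrow> E (g L a) (g L' a') \<longleftrightarrow> E a a'"
proof -
  let ?V = "Pow F \<times> A"
  define e where "e = from_nat_into ?V"
  have "countable ?V" using F(1) rado_countable[OF A] by (simp add: countable_finite)
  moreover have "infinite ?V" using rado_infinite[OF A] by (auto simp: finite_cartesian_product_iff)
  ultimately have e: "bij_betw e UNIV ?V" unfolding e_def by (rule bij_betw_from_nat_into)
  then have eV: "e n \<in> ?V" for n by (auto simp: bij_betw_def)
  \<comment> \<open>The type prescribed for the \<open>n\<close>-th vertex: the first part governs
    adjacency to \<open>F\<close>, the second copies the adjacency of indices to the earlier
    vertices.\<close>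
  let ?Z = "\<lambda>h n. fst (e n) \<union> {h i |i. i < n \<and> E (snd (e n)) (snd (e i))}"
  let ?P = "\<lambda>h n r. r \<in> piece E A (F \<union> h ` {..<n}) (?Z h n)"
  have "\<exists>h. \<forall>n. ?P h n (h n)"
  proof (rule dependent_wellorder_choice)
    fix r :: 'a and f g :: "nat \<Rightarrow> 'a" and n :: nat assume *: "\<And>y. y < n \<Longrightarrow> f y = g y"
    then have "f ` {..<n} = g ` {..<n}" by auto
    moreover have "?Z f n = ?Z g n" using * by metis
    ultimately show "?P f n r = ?P g n r" by simp
  next
    fix n :: nat and h :: "nat \<Rightarrow> 'a" assume *: "\<And>y. y < n \<Longrightarrow> ?P h y (h y)"
    have "h ` {..<n} \<subseteq> A" using * by (auto simp: piece_def)
    then show "\<exists>r. ?P h n r"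
      using rado_piece_nonempty[OF A, of "F \<union> h ` {..<n}" "?Z h n"] F by auto
  qed
  then obtain h where h: "\<And>n. ?P h n (h n)" by blast
  have hA: "h n \<in> A" and hF: "h n \<notin> F" and h_new: "i < n \<Longrightarrow> h n \<noteq> h i" for n i
    using h[of n] by (auto simp: piece_def)
  have h_eq: "h n = h i \<longleftrightarrow> n = i" for n i
    using h_new[of n i] h_new[of i n] by (metis linorder_neqE_nat)
  have type: "E (h n) x \<longleftrightarrow> x \<in> fst (e n)" if "x \<in> F" for n x
    using h[of n] that hF by (auto simp: piece_def)
  have adj_less: "E (h n) (h i) \<longleftrightarrow> E (snd (e n)) (snd (e i))" if "i < n" for n i
  proof -
    have "h i \<notin> fst (e n)" using eV[of n] hF[of i] by auto
    then show ?thesis using h[of n] that by (auto simp: piece_def h_eq)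
  qed
  have adj: "E (h n) (h i) \<longleftrightarrow> E (snd (e n)) (snd (e i))" for n i
  proof (cases rule: linorder_cases[of i n])
    case less
    then show ?thesis by (rule adj_less)
  next
    case equal
    then show ?thesis using rado_irrefl[OF A] hA eV by (metis mem_Times_iff)
  next
    case greater
    then show ?thesis
      using adj_less[of n i] rado_sym[OF A, of "h n" "h i"] rado_sym[OF A, of "snd (e n)" "snd (e i)"]
        hA eV[of n] eV[of i] by (simp add: mem_Times_iff)
  qed
  define g where "g L a = h (inv e (L, a))" for L a
  have e_inv: "e (inv e (L, a)) = (L, a)" if "L \<subseteq> F" "a \<in> A" for L a
    using e that by (intro f_inv_into_f) (auto simp: bij_betw_def)
  show ?thesis
  proof (rule that[of g])
    fix L a assume "L \<subseteq> F" "a \<in> A"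
    then show "g L a \<in> piece E A F L"
      using hA hF type e_inv[of L a] unfolding g_def piece_def by auto
    fix L' a' assume "L' \<subseteq> F" "a' \<in> A"
    show "L = L' \<and> a = a'" if "g L a = g L' a'"
      using e_inv[OF \<open>L \<subseteq> F\<close> \<open>a \<in> A\<close>] e_inv[OF \<open>L' \<subseteq> F\<close> \<open>a' \<in> A\<close>] that
      unfolding g_def h_eq by (metis prod.inject)
    show "E (g L a) (g L' a') \<longleftrightarrow> E a a'"
      using e_inv[OF \<open>L \<subseteq> F\<close> \<open>a \<in> A\<close>] e_inv[OF \<open>L' \<subseteq> F\<close> \<open>a' \<in> A\<close>]
      unfolding g_def adj by simp
  qed
qed

text \<open>Density is applied to the twin copy inside the piece of \<open>K\<close>, and the
  resulting set \<open>N\<close> of indices is then imposed on all pieces. Twins with the same index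
  have the same neighbours among the images of \<open>g\<close>, so a demand separating them over
  \<open>F\<close> could not be met; hence each index may survive in at most one piece.\<close>

lemma rado_shrink_piece:
  assumes A: "rado_graph A E" and F: "finite F" "F \<subseteq> A" and K: "K \<subseteq> F"
    and dense: "\<And>B. rado_graph B E \<Longrightarrow> B \<subseteq> A \<Longrightarrow> \<exists>C\<subseteq>B. rado_graph C E \<and> D C"
    and opn: "\<And>B C. D B \<Longrightarrow> C \<subseteq> B \<Longrightarrow> rado_graph C E \<Longrightarrow> D C"
  shows "\<exists>A'\<subseteq>A. F \<subseteq> A' \<and> rado_graph A' E \<and> D (piece E A' F K)"
proof -
  obtain g where g_piece: "\<And>L a. L \<subseteq> F \<Longrightarrow> a \<in> A \<Longrightarrow> g L a \<in> piece E A F L"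
    and g_inj: "\<And>L a L' a'. L \<subseteq> F \<Longrightarrow> a \<in> A \<Longrightarrow> L' \<subseteq> F \<Longrightarrow> a' \<in> A \<Longrightarrow> g L a = g L' a' \<Longrightarrow> L = L' \<and> a = a'"
    and g_E: "\<And>L a L' a'. L \<subseteq> F \<Longrightarrow> a \<in> A \<Longrightarrow> L' \<subseteq> F \<Longrightarrow> a' \<in> A \<Longrightarrow> E (g L a) (g L' a') \<longleftrightarrow> E a a'"
    by (rule rado_twins[OF A F], rule that; assumption)
  have inj_K: "inj_on (g K) A" using g_inj[OF K _ K] by (auto intro: inj_onI)
  have "rado_graph (g K ` A) E" using A inj_K g_E[OF K _ K] by (rule rado_image)
  moreover have "g K ` A \<subseteq> A" using g_piece[OF K] piece_subset by fastforce
  ultimately obtain B where B: "B \<subseteq> g K ` A" "rado_graph B E" "D B" using dense by meson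
  obtain N where N: "N \<subseteq> A" "B = g K ` N" using B(1) by (auto simp: subset_image_iff)
  \<comment> \<open>Since \<open>g K\<close> is an embedding, the index set \<open>N\<close> of
    \<open>B\<close> is again a copy.\<close>
  have "rado_graph (inv_into A (g K) ` B) E"
  proof (rule rado_image[OF B(2)])
    show "inj_on (inv_into A (g K)) B" using B(1) by (rule inj_on_inv_into)
    fix x y assume "x \<in> B" "y \<in> B"
    then obtain a b where "a \<in> A" "b \<in> A" "x = g K a" "y = g K b" using B(1) by blast
    then show "E (inv_into A (g K) x) (inv_into A (g K) y) \<longleftrightarrow> E x y"
      using inj_K g_E[OF K _ K] by simp
  qed
  moreover have "inv_into A (g K) ` B = N" using N inj_K by simp
  ultimately have N_rado: "rado_graph N E" by simp
  \<comment> \<open>The types over \<open>J\<close> of the form \<open>j ` L\<close> divide \<open>N\<close> among the types \<open>L\<close> over \<open>F\<close>: only the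
    twins with index in \<open>S L\<close> are kept in the piece of \<open>L\<close>. Each \<open>S L\<close> realizes all types over
    finite subsets of \<open>N - J\<close>, so every adjacency pattern survives.\<close>
  obtain J where J: "finite J" "card J = card F" "J \<subseteq> N"
    using infinite_arbitrarily_large[OF rado_infinite[OF N_rado]] by blast
  then obtain j where j: "bij_betw j F J" using finite_same_card_bij[OF F(1)] by metis
  define S where "S L = piece E N J (j ` L)" for L
  have S_N: "S L \<subseteq> N" for L unfolding S_def by (rule piece_subset)
  have S_J: "a \<notin> J" if "a \<in> S L" for a L using that by (simp add: S_def piece_def)
  have S_unique: "L = L'" if "a \<in> S L" "a \<in> S L'" "L \<subseteq> F" "L' \<subseteq> F" for a L L'
  proof -
    have "x \<in> j ` L \<longleftrightarrow> x \<in> j ` L'" if "x \<in> J" for x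
      using \<open>a \<in> S L\<close> \<open>a \<in> S L'\<close> that by (simp add: S_def piece_def)
    moreover have "j ` L \<subseteq> J" "j ` L' \<subseteq> J"
      using bij_betw_imp_surj_on[OF j] that(3,4) by blast+
    ultimately have "j ` L = j ` L'" by blast
    then show ?thesis using j that(3,4) by (metis bij_betw_def inj_on_image_eq_iff)
  qed
  define A' where "A' = F \<union> (\<Union>L\<in>Pow F. g L ` S L)"
  have g_F: "g L a \<notin> F" if "L \<subseteq> F" "a \<in> A" for L a using g_piece[OF that] by (simp add: piece_def)
  have A'D: "a \<in> S L" if "g L a \<in> A'" "L \<subseteq> F" "a \<in> A" for L a
  proof -
    from that g_F[OF that(2,3)] obtain L' a' where *: "L' \<subseteq> F" "a' \<in> S L'" "g L a = g L' a'"
      unfolding A'_def by blast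
    then show ?thesis using g_inj[OF that(2,3), of L' a'] S_N N(1) by blast
  qed
  have "A' \<subseteq> A"
  proof -
    have "g L a \<in> A" if "L \<subseteq> F" "a \<in> S L" for L a
      using g_piece[of L a] that S_N N(1) piece_subset[of E A F L] by blast
    then show ?thesis using F(2) unfolding A'_def by blast
  qed
  have "rado_graph A' E"
  proof (rule rado_subsetI[OF A \<open>A' \<subseteq> A\<close>])
    fix H Z assume H: "finite H" "H \<subseteq> A'"
    \<comment> \<open>The demand is translated to indices: \<open>L\<close> is its part on
      \<open>F\<close>, \<open>T\<close> collects the indices of the twins in \<open>H\<close>, and
      \<open>Y\<close> those with a twin in \<open>H \<inter> Z\<close>.\<close>
    define L where "L = Z \<inter> F"
    have L: "L \<subseteq> F" by (simp add: L_def)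
    define T where "T = {a \<in> N. \<exists>M\<subseteq>F. g M a \<in> H}"
    define Y where "Y = {a \<in> N. \<exists>M\<subseteq>F. g M a \<in> H \<inter> Z}"
    have "inj_on (\<lambda>(M, a). g M a) (Pow F \<times> A)"
      using g_inj by (auto intro!: inj_onI)
    from finite_vimage_IntI[OF H(1) this]
    have "finite (snd ` ((\<lambda>(M, a). g M a) -` H \<inter> (Pow F \<times> A)))" by simp
    moreover have "T \<subseteq> snd ` ((\<lambda>(M, a). g M a) -` H \<inter> (Pow F \<times> A))"
      using N(1) unfolding T_def by force
    ultimately have T: "finite T" by (rule finite_subset[rotated])
    have TJ: "a \<notin> J" if "a \<in> T" for a
    proof -
      from that obtain M where "M \<subseteq> F" "g M a \<in> A'" "a \<in> A"
        using H(2) N(1) unfolding T_def by blast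
      then show ?thesis using A'D S_J by blast
    qed
    \<comment> \<open>The part of the type over \<open>J\<close> puts \<open>a\<close> into
      \<open>S L\<close>, the part over \<open>T\<close> gives the required adjacencies. They do not
      interfere, as \<open>T\<close> is disjoint from \<open>J\<close>.\<close>
    obtain a where a: "a \<in> piece E N (J \<union> T) (j ` L \<union> Y)"
      using rado_piece_nonempty[OF N_rado, of "J \<union> T"] J T unfolding T_def by blast
    then have aN: "a \<in> N" "a \<notin> T" by (auto simp: piece_def)
    then have aA: "a \<in> A" using N(1) by blast
    have "Y \<subseteq> T" unfolding Y_def T_def by blast
    then have "a \<in> S L" using a TJ unfolding S_def piece_def by blast
    have jL: "j ` L \<subseteq> J" using j L by (auto simp: bij_betw_def)
    have "g L a \<in> piece E A' H Z"
      unfolding piece_def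
    proof (intro CollectI conjI ballI DiffI)
      show "g L a \<in> A'" using \<open>a \<in> S L\<close> L unfolding A'_def by blast
      show "g L a \<notin> H" using aN L unfolding T_def by blast
      fix x assume x: "x \<in> H"
      show "E (g L a) x \<longleftrightarrow> x \<in> Z"
      proof (cases "x \<in> F")
        case True
        then show ?thesis using g_piece[OF L aA] by (simp add: piece_def L_def)
      next
        case False
        then obtain M b where M: "M \<subseteq> F" "b \<in> S M" "x = g M b" using x H(2) unfolding A'_def by blast
        then have b: "b \<in> N" "b \<in> A" using S_N N(1) by blast+
        then have bT: "b \<in> T" using M x unfolding T_def by blast
        have "E (g L a) x \<longleftrightarrow> E a b" unfolding M(3) using g_E L aA M(1) b(2) by blast
        also have "\<dots> \<longleftrightarrow> b \<in> Y" using a bT TJ[OF bT] jL unfolding piece_def by blast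
        also have "\<dots> \<longleftrightarrow> x \<in> Z"
        proof
          assume "b \<in> Y"
          then obtain M' where M': "M' \<subseteq> F" "g M' b \<in> H \<inter> Z" unfolding Y_def by blast
          then have "b \<in> S M'" using A'D H(2) b(2) by blast
          \<comment> \<open>An index survives in one piece only, so the twin that witnesses
            \<open>b \<in> Y\<close> is \<open>x\<close> itself.\<close>
          then have "M' = M" using S_unique M' M by blast
          then show "x \<in> Z" using M' M(3) by blast
        qed (use x M b in \<open>auto simp: Y_def\<close>)
        finally show ?thesis .
      qed
    qed
    then show "piece E A' H Z \<noteq> {}" by blast
  qed
  moreover have "piece E A' F K \<subseteq> B"
  proof
    fix v assume v: "v \<in> piece E A' F K"
    then obtain L a where L: "L \<subseteq> F" "a \<in> S L" "v = g L a" unfolding piece_def A'_def by blast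
    then have "a \<in> N" "a \<in> A" using S_N N(1) by blast+
    then have "v \<in> piece E A F L" using g_piece L by blast
    then have "L = K" using v L(1) K unfolding piece_def by blast
    then show "v \<in> B" using L(3) \<open>a \<in> N\<close> N(2) by blast
  qed
  moreover have "F \<subseteq> A'" unfolding A'_def by blast
  ultimately have "D (piece E A' F K)" using opn[OF B(3)] rado_piece F(1) by meson
  then show ?thesis using \<open>A' \<subseteq> A\<close> \<open>F \<subseteq> A'\<close> \<open>rado_graph A' E\<close> by blast
qed

text \<open>The finitely many types over \<open>F\<close> are treated one after another; the pieces
  already treated only shrink, and \<open>opn\<close> keeps them in \<open>D\<close>.\<close>

lemma rado_shrink_pieces:
  assumes A: "rado_graph A E" and F: "finite F" "F \<subseteq> A"
    and dense: "\<And>B. rado_graph B E \<Longrightarrow> B \<subseteq> A \<Longrightarrow> \<exists>C\<subseteq>B. rado_graph C E \<and> D C"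
    and opn: "\<And>B C. D B \<Longrightarrow> C \<subseteq> B \<Longrightarrow> rado_graph C E \<Longrightarrow> D C"
  shows "\<exists>A'\<subseteq>A. F \<subseteq> A' \<and> rado_graph A' E \<and> (\<forall>Z. D (piece E A' F Z))"
proof -
  have "finite \<K> \<Longrightarrow> \<K> \<subseteq> Pow F \<Longrightarrow>
      \<exists>A'\<subseteq>A. F \<subseteq> A' \<and> rado_graph A' E \<and> (\<forall>K\<in>\<K>. D (piece E A' F K))" for \<K>
  proof (induction \<K> rule: finite_induct)
    case empty
    then show ?case using A F(2) by blast
  next
    case (insert K \<K>)
    then obtain B where B: "B \<subseteq> A" "F \<subseteq> B" "rado_graph B E" "\<forall>K\<in>\<K>. D (piece E B F K)" by auto
    have "\<exists>A'\<subseteq>B. F \<subseteq> A' \<and> rado_graph A' E \<and> D (piece E A' F K)"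
    proof (rule rado_shrink_piece[OF B(3) F(1) B(2)])
      show "K \<subseteq> F" using insert.prems by blast
      show "\<exists>C\<subseteq>B'. rado_graph C E \<and> D C" if "rado_graph B' E" "B' \<subseteq> B" for B'
        using dense that B(1) by blast
    qed (rule opn)
    then obtain A' where A': "A' \<subseteq> B" "F \<subseteq> A'" "rado_graph A' E" "D (piece E A' F K)" by blast
    have "D (piece E A' F L)" if "L \<in> \<K>" for L
      using opn[of "piece E B F L" "piece E A' F L"] B(4) that piece_mono[OF A'(1), of F F L L E]
        rado_piece[OF A'(3) F(1) A'(2)] by blast
    with A' B(1) show ?case by (intro exI[of _ A']) auto
  qed
  from this[of "Pow F"] F(1) obtain A' where
    A': "A' \<subseteq> A" "F \<subseteq> A'" "rado_graph A' E" "\<And>K. K \<subseteq> F \<Longrightarrow> D (piece E A' F K)" by auto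
  have "piece E A' F Z = piece E A' F (Z \<inter> F)" for Z by (auto simp: piece_def)
  then have "D (piece E A' F Z)" for Z using A'(4)[of "Z \<inter> F"] by simp
  with A'(1-3) show ?thesis by blast
qed

text \<open>The first fusion, with \<open>D n\<close> in the role of deciding the
  \<open>n\<close>-th value. A stage is a finite set \<open>F\<close> that is kept for good and a
  copy \<open>B\<close> from which later vertices are taken. After a vertex is added for the demand
  \<open>e n\<close>, \<open>B\<close> is shrunk until every type over the new \<open>F\<close>
  decides.\<close>

lemma rado_continuous_reading:
  fixes D :: "nat \<Rightarrow> 'a set \<Rightarrow> bool"
  assumes A: "rado_graph A E"
    and dense: "\<And>n B. rado_graph B E \<Longrightarrow> B \<subseteq> A \<Longrightarrow> \<exists>C\<subseteq>B. rado_graph C E \<and> D n C"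
    and opn: "\<And>n B C. D n B \<Longrightarrow> C \<subseteq> B \<Longrightarrow> rado_graph C E \<Longrightarrow> D n C"
  shows "\<exists>B\<subseteq>A. rado_graph B E \<and> (\<forall>n. \<exists>F. finite F \<and> F \<subseteq> B \<and> (\<forall>Z. D n (piece E B F Z)))"
proof -
  obtain e :: "nat \<Rightarrow> 'a set" where e: "\<And>K m. finite K \<Longrightarrow> K \<subseteq> A \<Longrightarrow> \<exists>n\<ge>m. e n = K"
    using enumerate_finite_subsets[OF rado_countable[OF A]] by blast
  let ?P = "\<lambda>(F, B). finite F \<and> F \<subseteq> B \<and> B \<subseteq> A \<and> rado_graph B E"
  let ?Q = "\<lambda>n (F, B) (F', B'). B' \<subseteq> B \<and> (\<exists>v\<in>piece E B F (e n). F' = insert v F) \<and>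
    (\<forall>Z. D n (piece E B' F' Z))"
  have "\<exists>f. \<forall>n. ?P (f n) \<and> ?Q n (f n) (f (Suc n))"
  proof (rule dependent_nat_choice)
    show "\<exists>x. ?P x" using A by (intro exI[of _ "({}, A)"]) simp
    fix x n assume "?P x"
    then obtain F B where x: "x = (F, B)" and B: "finite F" "F \<subseteq> B" "B \<subseteq> A" "rado_graph B E"
      by (cases x) auto
    obtain v where v: "v \<in> piece E B F (e n)" using rado_piece_nonempty[OF B(4,1,2)] by blast
    then have "insert v F \<subseteq> B" using B(2) by (auto simp: piece_def)
    have "\<exists>B'\<subseteq>B. insert v F \<subseteq> B' \<and> rado_graph B' E \<and> (\<forall>Z. D n (piece E B' (insert v F) Z))"
    proof (rule rado_shrink_pieces[OF B(4) _ \<open>insert v F \<subseteq> B\<close>])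
      show "\<exists>C\<subseteq>B'. rado_graph C E \<and> D n C" if "rado_graph B' E" "B' \<subseteq> B" for B'
        using dense that B(3) by blast
    qed (use B(1) opn in auto)
    then obtain B' where "B' \<subseteq> B" "insert v F \<subseteq> B'" "rado_graph B' E"
        "\<forall>Z. D n (piece E B' (insert v F) Z)" by blast
    then show "\<exists>y. ?P y \<and> ?Q n x y"
      using v B unfolding x
      by (intro exI[of _ "(insert v F, B')"]) (simp only: prod.case finite_insert, blast)
  qed
  then obtain f where f: "\<forall>n. ?P (f n) \<and> ?Q n (f n) (f (Suc n))" ..
  define F where "F n = fst (f n)" for n
  define B where "B n = snd (f n)" for n
  have f_eq: "f n = (F n, B n)" for n by (simp add: F_def B_def)
  have P: "finite (F n)" "F n \<subseteq> B n" "B n \<subseteq> A" "rado_graph (B n) E" for n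
    using f[rule_format, of n] unfolding f_eq by auto
  have Q: "B (Suc n) \<subseteq> B n" "\<exists>v\<in>piece E (B n) (F n) (e n). F (Suc n) = insert v (F n)"
      "\<And>Z. D n (piece E (B (Suc n)) (F (Suc n)) Z)" for n
    using f[rule_format, of n] unfolding f_eq prod.case by blast+
  define C where "C = (\<Union>n. F n)"
  have F_mono: "F m \<subseteq> F n" if "m \<le> n" for m n
    using _ that by (rule lift_Suc_mono_le) (use Q(2) in blast)
  have B_mono: "B n \<subseteq> B m" if "m \<le> n" for m n
    using _ that by (rule lift_Suc_antimono_le) (use Q(1) in blast)
  \<comment> \<open>Kept vertices remain in all copies, so the limit lies inside each
    \<open>B n\<close> and its pieces inherit \<open>D n\<close>.\<close>
  have "F m \<subseteq> B n" for m n
    using F_mono[of m "max m n"] P(2)[of "max m n"] B_mono[of n "max m n"] by auto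
  then have C_B: "C \<subseteq> B n" for n unfolding C_def by blast
  then have "C \<subseteq> A" using P(3) by blast
  have C: "rado_graph C E" unfolding C_def
  proof (rule rado_Union[OF A e])
    show "F n \<subseteq> A" for n using P by blast
    show "\<exists>v\<in>piece E A (F n) (e n). F (Suc n) = insert v (F n)" for n
    proof -
      have "piece E (B n) (F n) (e n) \<subseteq> piece E A (F n) (e n)" by (rule piece_mono[OF P(3)]) auto
      then show ?thesis using Q(2)[of n] by blast
    qed
  qed
  have "D n (piece E C (F (Suc n)) Z)" for n Z
  proof (rule opn[OF Q(3)])
    show "piece E C (F (Suc n)) Z \<subseteq> piece E (B (Suc n)) (F (Suc n)) Z"
      by (rule piece_mono[OF C_B]) auto
    show "rado_graph (piece E C (F (Suc n)) Z) E"
      by (rule rado_piece[OF C P(1)]) (auto simp: C_def)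
  qed
  then have "\<forall>n. \<exists>F. finite F \<and> F \<subseteq> C \<and> (\<forall>Z. D n (piece E C F Z))"
    using P(1) by (intro allI exI[of _ "F (Suc _)"]) (auto simp: C_def)
  with C \<open>C \<subseteq> A\<close> show ?thesis by blast
qed

section \<open>Two-branching copies\<close>

text \<open>An infinite set of successors would contain three of them as well, so excluding three
  distinct successors gives finiteness together with the bound.\<close>

lemma binary_subtreeI:
  assumes closed: "\<And>s t. t \<in> T \<Longrightarrow> prefix s t \<Longrightarrow> s \<in> T"
    and branch: "\<And>t a b c. t @ [a] \<in> T \<Longrightarrow> t @ [b] \<in> T \<Longrightarrow> t @ [c] \<in> T \<Longrightarrow> a = b \<or> b = c \<or> a = c"
  shows "binary_subtree T"
  unfolding binary_subtree_def
proof (intro conjI ballI allI impI)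
  show "s \<in> T" if "t \<in> T" "prefix s t" for s t using closed that .
  fix t
  let ?S = "{s\<in>T. \<exists>n. s = t @ [n]}"
  have no3: "\<not> (X \<subseteq> ?S \<and> card X = 3)" for X
  proof
    assume X: "X \<subseteq> ?S \<and> card X = 3"
    then obtain x y z where X_eq: "X = {x, y, z}" and "x \<noteq> y" "y \<noteq> z" "x \<noteq> z"
      by (auto simp: card_3_iff)
    moreover obtain a b c where "x = t @ [a]" "y = t @ [b]" "z = t @ [c]"
      using X X_eq by auto
    ultimately show False using branch[of t a b c] X by auto
  qed
  show fin: "finite ?S"
    using no3 infinite_arbitrarily_large[of ?S 3] by blast
  show "card ?S \<le> 2"
  proof (rule ccontr)
    assume "\<not> card ?S \<le> 2"
    then have "3 \<le> card ?S" by simp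
    then obtain X where "X \<subseteq> ?S" "card X = 3" by (rule obtain_subset_with_card_n)
    then show False using no3 by blast
  qed
qed

section \<open>Nowhere constant continuous functions and the second fusion\<close>

lemma finite_functions_separated:
  fixes S :: "(nat \<Rightarrow> 'b) set"
  assumes "finite S"
  shows "\<exists>N>m. \<forall>g\<in>S. \<forall>h\<in>S. (\<forall>k<N. g k = h k) \<longrightarrow> g = h"
proof -
  have "\<forall>p. \<exists>k. fst p \<noteq> snd p \<longrightarrow> fst p k \<noteq> (snd p :: nat \<Rightarrow> 'b) k" by (auto simp: fun_eq_iff)
  then obtain d where d: "\<And>p. fst p \<noteq> snd p \<Longrightarrow> fst p (d p) \<noteq> (snd p :: nat \<Rightarrow> 'b) (d p)"
    by metis
  define N where "N = Suc (Max (insert m (d ` (S \<times> S))))"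
  have fin: "finite (insert m (d ` (S \<times> S)))" using assms by simp
  have "d (g, h) < N" if "g \<in> S" "h \<in> S" for g h
  proof -
    have "d (g, h) \<in> insert m (d ` (S \<times> S))" using that by blast
    then show ?thesis unfolding N_def less_Suc_eq_le by (rule Max_ge[OF fin])
  qed
  then have "g = h" if "g \<in> S" "h \<in> S" "\<forall>k<N. g k = h k" for g h
    using d[of "(g, h)"] that by auto
  moreover have "m < N" unfolding N_def less_Suc_eq_le by (rule Max_ge[OF fin]) simp
  ultimately show ?thesis by (intro exI[of _ N]) simp
qed

text \<open>\<open>f\<close> is a continuous map from sets of vertices to Baire space, with
  \<open>supp\<close> as its modulus of continuity; the last assumption excludes that it is constant
  on a basic open set.\<close>

locale nonconstant_reading =
  fixes A :: "'a set" and E :: "'a \<Rightarrow> 'a \<Rightarrow> bool"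
    and f :: "'a set \<Rightarrow> nat \<Rightarrow> nat" and supp :: "nat \<Rightarrow> 'a set"
  assumes A: "rado_graph A E"
    and supp: "finite (supp n)" "supp n \<subseteq> A"
    and f_cong: "Z \<inter> supp n = Z' \<inter> supp n \<Longrightarrow> f Z n = f Z' n"
    and nonconstant: "finite G \<Longrightarrow> G \<subseteq> A \<Longrightarrow> \<exists>Z. Z \<inter> G = U \<inter> G \<and> f Z \<noteq> h"
begin

lemma f_cong_superset: "supp n \<subseteq> G \<Longrightarrow> Z \<inter> G = Z' \<inter> G \<Longrightarrow> f Z n = f Z' n"
  by (rule f_cong) (metis Int_assoc inf.absorb2)

text \<open>The members of \<open>Y\<close> are avoided one at a time. Once \<open>f Z\<close>
  differs from \<open>y\<close> at \<open>n\<close>, adding \<open>supp n\<close> to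
  \<open>G\<close> preserves this difference while the others are avoided.\<close>

lemma avoid_finite:
  assumes "finite Y" "finite G" "G \<subseteq> A"
  shows "\<exists>Z. Z \<inter> G = U \<inter> G \<and> f Z \<notin> Y"
  using assms
proof (induction Y arbitrary: G U rule: finite_induct)
  case (insert y Y)
  obtain Z where Z: "Z \<inter> G = U \<inter> G" "f Z \<noteq> y" using nonconstant[OF insert.prems, of U y] by blast
  then obtain n where n: "f Z n \<noteq> y n" by (auto simp: fun_eq_iff)
  obtain Z' where Z': "Z' \<inter> (G \<union> supp n) = Z \<inter> (G \<union> supp n)" "f Z' \<notin> Y"
    using insert.IH[of "G \<union> supp n" Z] insert.prems supp by auto
  have "f Z' n = f Z n" using Z'(1) by (intro f_cong_superset[of n "G \<union> supp n"]) auto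
  then have "f Z' \<noteq> y" using n by auto
  moreover have "Z' \<inter> G = U \<inter> G" using Z(1) Z'(1) by blast
  ultimately show ?case using Z'(2) by blast
qed auto

text \<open>The types are extended one at a time, each avoiding the finitely many values of
  \<open>f\<close> already used.\<close>

lemma choose_distinct:
  assumes G: "finite G" "G \<subseteq> A" and "finite \<U>"
  shows "\<exists>z. (\<forall>U\<in>\<U>. z U \<inter> G = U \<inter> G) \<and> inj_on (\<lambda>U. f (z U)) \<U>"
  using assms(3)
proof induction
  case (insert U \<U>)
  then obtain z where z: "\<forall>U\<in>\<U>. z U \<inter> G = U \<inter> G" "inj_on (\<lambda>U. f (z U)) \<U>" by blast
  obtain Z where Z: "Z \<inter> G = U \<inter> G" "f Z \<notin> (\<lambda>U. f (z U)) ` \<U>"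
    using avoid_finite[OF finite_imageI[OF insert.hyps(1)] G] by metis
  define z' where "z' = z(U := Z)"
  have z'_old: "z' V = z V" if "V \<in> \<U>" for V
    using that insert.hyps(2) by (auto simp: z'_def)
  have "inj_on (\<lambda>V. f (z' V)) \<U>" using z(2) by (simp add: z'_old cong: inj_on_cong)
  moreover have "(\<lambda>V. f (z' V)) ` \<U> = (\<lambda>V. f (z V)) ` \<U>" by (rule image_cong) (simp_all add: z'_old)
  moreover have "z' U = Z" by (simp add: z'_def)
  ultimately have "inj_on (\<lambda>V. f (z' V)) (insert U \<U>)"
    using Z(2) insert.hyps(2) by (simp add: inj_on_insert)
  moreover have "\<forall>V\<in>insert U \<U>. z' V \<inter> G = V \<inter> G"
    using z(1) Z(1) z'_old \<open>z' U = Z\<close> by simp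
  ultimately show ?case by blast
qed simp

text \<open>
  In a stage, \<open>F\<close> is the part of the subcopy built so far, and \<open>\<U>\<close> is the set of types over the
  larger set \<open>G\<close> that are kept, at least one for each type over \<open>F\<close>; the first \<open>N\<close> values of \<open>f\<close>
  determine which one.
\<close>

definition stage :: "'a set \<Rightarrow> 'a set \<Rightarrow> nat \<Rightarrow> 'a set set \<Rightarrow> bool" where
  "stage F G N \<U> \<longleftrightarrow> F \<subseteq> G \<and> finite G \<and> G \<subseteq> A \<and> \<U> \<subseteq> Pow G \<and>
    (\<forall>K\<subseteq>F. \<exists>U\<in>\<U>. U \<inter> F = K) \<and> (\<forall>k<N. supp k \<subseteq> G) \<and>
    (\<forall>Z Z'. Z \<inter> G \<in> \<U> \<longrightarrow> Z' \<inter> G \<in> \<U> \<longrightarrow> (\<forall>k<N. f Z k = f Z' k) \<longrightarrow> Z \<inter> G = Z' \<inter> G)"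

lemma stage_initial: "stage {} {} 0 {{}}"
  by (auto simp: stage_def)

text \<open>The clause on the neighbours of \<open>v\<close> makes the values read off at
  \<open>v\<close> follow a kept type. The last clause bounds the branching by two;
  \<open>V0\<close> and \<open>V1\<close> may be arbitrary where fewer kept types lie above
  \<open>U\<close>.\<close>

definition extends :: "'a \<Rightarrow> 'a set \<Rightarrow> nat \<Rightarrow> 'a set set \<Rightarrow> 'a set \<Rightarrow> nat \<Rightarrow> 'a set set \<Rightarrow> bool" where
  "extends v G N \<U> G' N' \<U>' \<longleftrightarrow> v \<notin> G \<and> {x. E v x} \<inter> G \<in> \<U> \<and> G \<subseteq> G' \<and> N < N' \<and>
    (\<forall>V\<in>\<U>'. V \<inter> G \<in> \<U>) \<and> (\<forall>U. \<exists>V0 V1. \<forall>V\<in>\<U>'. V \<inter> G = U \<longrightarrow> V = V0 \<or> V = V1)"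

text \<open>Every kept type splits in two according to whether it contains the new vertex. Each of
  the resulting types is extended to a set with its own value of \<open>f\<close>, and only the
  traces of these sets are kept.\<close>

lemma stage_step:
  assumes st: "stage F G N \<U>"
  shows "\<exists>v G' N' \<U>'. v \<in> piece E A F S \<and> stage (insert v F) G' N' \<U>' \<and> extends v G N \<U> G' N' \<U>'"
proof -
  have G: "F \<subseteq> G" "finite G" "G \<subseteq> A" "\<U> \<subseteq> Pow G" "\<And>K. K \<subseteq> F \<Longrightarrow> \<exists>U\<in>\<U>. U \<inter> F = K"
      "\<And>k. k < N \<Longrightarrow> supp k \<subseteq> G"
    using st unfolding stage_def by auto
  \<comment> \<open>Some kept type has the demanded trace on \<open>F\<close>; a vertex realizing it
    over \<open>G\<close> meets the demand and has a kept type.\<close>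
  obtain U0 where U0: "U0 \<in> \<U>" "U0 \<inter> F = S \<inter> F" using G(5)[of "S \<inter> F"] by auto
  obtain v where v: "v \<in> piece E A G U0" using rado_piece_nonempty[OF A G(2,3)] by blast
  have vA: "v \<in> A" "v \<notin> G" using v by (auto simp: piece_def)
  have vF: "v \<in> piece E A F S" using v piece_mono[OF order_refl G(1) U0(2)] by blast
  have vU0: "{x. E v x} \<inter> G = U0" using v U0(1) G(4) unfolding piece_def by blast
  define G1 where "G1 = insert v G"
  have G1: "finite G1" "G1 \<subseteq> A" using G(2,3) vA by (auto simp: G1_def)
  define \<U>1 where "\<U>1 = \<U> \<union> insert v ` \<U>"
  have fin: "finite \<U>1" using G(2,4) unfolding \<U>1_def by (simp add: finite_subset)
  have \<U>1_G1: "V \<inter> G1 = V" "V \<inter> G \<in> \<U>" if "V \<in> \<U>1" for V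
  proof -
    from that obtain U where U: "U \<in> \<U>" "V = U \<or> V = insert v U" unfolding \<U>1_def by blast
    then show "V \<inter> G1 = V" "V \<inter> G \<in> \<U>"
      using G(4) vA(2) by (auto simp: G1_def Int_absorb2)
  qed
  obtain z where z: "\<forall>V\<in>\<U>1. z V \<inter> G1 = V \<inter> G1" "inj_on (\<lambda>V. f (z V)) \<U>1"
    using choose_distinct[OF G1 fin] by blast
  have z_G1: "z V \<inter> G1 = V" if "V \<in> \<U>1" for V using z(1) \<U>1_G1(1) that by auto
  \<comment> \<open>The first \<open>N'\<close> values tell the chosen functions apart. Including
    their supports in \<open>G'\<close> makes these values depend only on the trace on
    \<open>G'\<close>.\<close>
  obtain N' where N': "N' > N"
      "\<And>V W. V \<in> \<U>1 \<Longrightarrow> W \<in> \<U>1 \<Longrightarrow> (\<forall>k<N'. f (z V) k = f (z W) k) \<Longrightarrow> f (z V) = f (z W)"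
    using finite_functions_separated[of "(\<lambda>V. f (z V)) ` \<U>1" N] fin by (auto simp: Ball_def)
  define G' where "G' = G1 \<union> (\<Union>k<N'. supp k)"
  define \<U>' where "\<U>' = (\<lambda>V. z V \<inter> G') ` \<U>1"
  have G'G1: "G1 \<subseteq> G'" unfolding G'_def by blast
  have G_G1: "G \<subseteq> G1" unfolding G1_def by blast
  have \<U>'D: "\<exists>V\<in>\<U>1. W = z V \<inter> G' \<and> W \<inter> G1 = V" if "W \<in> \<U>'" for W
    using that z_G1 G'G1 unfolding \<U>'_def by blast
  have "stage (insert v F) G' N' \<U>'"
    unfolding stage_def
  proof (intro conjI allI impI)
    show "insert v F \<subseteq> G'" using G(1) G_G1 G'G1 unfolding G1_def by blast
    show "finite G'" using G1(1) supp(1) unfolding G'_def by blast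
    show "G' \<subseteq> A" using G1(2) supp(2) unfolding G'_def by blast
    show "\<U>' \<subseteq> Pow G'" unfolding \<U>'_def by blast
    show "supp k \<subseteq> G'" if "k < N'" for k using that unfolding G'_def by blast
  next
    fix K assume K: "K \<subseteq> insert v F"
    obtain U where U: "U \<in> \<U>" "U \<inter> F = K \<inter> F" using G(5)[of "K \<inter> F"] by auto
    define V where "V = (if v \<in> K then insert v U else U)"
    have "V \<in> \<U>1" using U(1) unfolding V_def \<U>1_def by auto
    have "v \<notin> U" "v \<notin> F" using U(1) G(1,4) vA(2) by auto
    then have "V \<inter> insert v F = K" using K U(2) unfolding V_def by (cases "v \<in> K") auto
    moreover have "insert v F \<subseteq> G1" using G(1) unfolding G1_def by blast
    ultimately have "z V \<inter> G' \<inter> insert v F = K" using z_G1[OF \<open>V \<in> \<U>1\<close>] G'G1 by blast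
    then show "\<exists>U\<in>\<U>'. U \<inter> insert v F = K" using \<open>V \<in> \<U>1\<close> unfolding \<U>'_def by blast
  next
    fix Z Z' assume Z: "Z \<inter> G' \<in> \<U>'" "Z' \<inter> G' \<in> \<U>'" "\<forall>k<N'. f Z k = f Z' k"
    obtain V V' where V: "V \<in> \<U>1" "Z \<inter> G' = z V \<inter> G'" "V' \<in> \<U>1" "Z' \<inter> G' = z V' \<inter> G'"
      using Z(1,2) unfolding \<U>'_def by blast
    have "f Z k = f (z V) k" "f Z' k = f (z V') k" if "k < N'" for k
      using f_cong_superset[of k G'] that V(2,4) unfolding G'_def by blast+
    then have "f (z V) = f (z V')" using N'(2)[OF V(1,3)] Z(3) by metis
    then have "V = V'" using z(2) V(1,3) by (auto dest: inj_onD)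
    then show "Z \<inter> G' = Z' \<inter> G'" using V by simp
  qed
  moreover have "extends v G N \<U> G' N' \<U>'"
    unfolding extends_def
  proof (intro conjI allI ballI)
    show "v \<notin> G" "N < N'" by fact+
    show "{x. E v x} \<inter> G \<in> \<U>" using vU0 U0(1) by simp
    show "G \<subseteq> G'" using G_G1 G'G1 by blast
    show "V \<inter> G \<in> \<U>" if W: "V \<in> \<U>'" for V
    proof -
      obtain V' where "V' \<in> \<U>1" "V \<inter> G1 = V'" using \<U>'D[OF W] by blast
      moreover have "V \<inter> G = V \<inter> G1 \<inter> G" using G_G1 by blast
      ultimately show ?thesis using \<U>1_G1(2) by metis
    qed
    fix U
    have "V = z U \<inter> G' \<or> V = z (insert v U) \<inter> G'" if V: "V \<in> \<U>'" "V \<inter> G = U" for V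
    proof -
      obtain W where W: "W \<in> \<U>1" "V = z W \<inter> G'" "V \<inter> G1 = W" using \<U>'D[OF V(1)] by blast
      have "W = U \<or> W = insert v U" using W(3) V(2) unfolding G1_def by blast
      then show ?thesis using W(2) by blast
    qed
    then show "\<exists>V0 V1. \<forall>V\<in>\<U>'. V \<inter> G = U \<longrightarrow> V = V0 \<or> V = V1"
      by (intro exI[of _ "z U \<inter> G'"] exI[of _ "z (insert v U) \<inter> G'"]) simp
  qed
  ultimately show ?thesis using vF by blast
qed

text \<open>The second fusion iterates \<open>stage_step\<close> along the demands
  \<open>e n\<close>. The vertex added at step \<open>i\<close> has a kept type over
  \<open>G i\<close>, hence over every earlier \<open>G n\<close>; so the first \<open>n\<close>
  values read at a vertex outside the finite set \<open>G n\<close> form a node of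
  \<open>T\<close>.\<close>

theorem two_branching:
  "\<exists>B T. B \<subseteq> A \<and> rado_graph B E \<and> binary_subtree T \<and>
    (\<forall>n. \<exists>G. finite G \<and> (\<forall>k<n. supp k \<subseteq> G) \<and> (\<forall>v\<in>B - G. map (f {x. E v x}) [0..<n] \<in> T))"
proof -
  obtain e :: "nat \<Rightarrow> 'a set" where e: "\<And>K m. finite K \<Longrightarrow> K \<subseteq> A \<Longrightarrow> \<exists>n\<ge>m. e n = K"
    using enumerate_finite_subsets[OF rado_countable[OF A]] by blast
  \<comment> \<open>The clause for \<open>n = 0\<close> records the start of the fusion; it
    guarantees that the least stages chosen below are successors.\<close>
  let ?P = "\<lambda>(n :: nat) (F, G, N, \<U>). stage F G N \<U> \<and> (n = 0 \<longrightarrow> F = {} \<and> N = 0)"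
  let ?Q = "\<lambda>n (F, G, N, \<U>) (F', G', N', \<U>').
    \<exists>v. v \<in> piece E A F (e n) \<and> F' = insert v F \<and> extends v G N \<U> G' N' \<U>'"
  have "\<exists>s. \<forall>n. ?P n (s n) \<and> ?Q n (s n) (s (Suc n))"
  proof (rule dependent_nat_choice)
    show "\<exists>x. ?P 0 x" using stage_initial by (intro exI[of _ "({}, {}, 0, {{}})"]) simp
    fix x n assume "?P n x"
    moreover obtain F G N \<U> where x: "x = (F, G, N, \<U>)" by (rule prod_cases4)
    ultimately have "stage F G N \<U>" by simp
    from stage_step[OF this, of "e n"] obtain v G' N' \<U>' where
      "v \<in> piece E A F (e n)" "stage (insert v F) G' N' \<U>'" "extends v G N \<U> G' N' \<U>'" by blast
    then show "\<exists>y. ?P (Suc n) y \<and> ?Q n x y"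
      unfolding x by (intro exI[of _ "(insert v F, G', N', \<U>')"]) (simp only: prod.case, blast)
  qed
  then obtain s where s: "\<forall>n. ?P n (s n) \<and> ?Q n (s n) (s (Suc n))" ..
  define F where "F n = fst (s n)" for n
  define G where "G n = fst (snd (s n))" for n
  define N where "N n = fst (snd (snd (s n)))" for n
  define \<U> where "\<U> n = snd (snd (snd (s n)))" for n
  have s_eq: "s n = (F n, G n, N n, \<U> n)" for n by (simp add: F_def G_def N_def \<U>_def)
  have st: "stage (F n) (G n) (N n) (\<U> n)" for n using s[rule_format, of n] unfolding s_eq by simp
  have init: "F 0 = {}" "N 0 = 0" using s[rule_format, of 0] unfolding s_eq by simp_all
  have "\<exists>v. v \<in> piece E A (F n) (e n) \<and> F (Suc n) = insert v (F n) \<and>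
      extends v (G n) (N n) (\<U> n) (G (Suc n)) (N (Suc n)) (\<U> (Suc n))" for n
    using s[rule_format, of n] unfolding s_eq by simp
  then obtain v where v: "\<And>n. v n \<in> piece E A (F n) (e n)" "\<And>n. F (Suc n) = insert (v n) (F n)"
      and ext: "\<And>n. extends (v n) (G n) (N n) (\<U> n) (G (Suc n)) (N (Suc n)) (\<U> (Suc n))" by metis
  have FG: "F n \<subseteq> G n" "G n \<subseteq> A" "finite (G n)" and supp_G: "k < N n \<Longrightarrow> supp k \<subseteq> G n"
    and \<U>_eq: "Z \<inter> G n \<in> \<U> n \<Longrightarrow> Z' \<inter> G n \<in> \<U> n \<Longrightarrow> (\<And>k. k < N n \<Longrightarrow> f Z k = f Z' k) \<Longrightarrow>
      Z \<inter> G n = Z' \<inter> G n" for n k Z Z'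
    using st[of n] unfolding stage_def by auto
  have G_Suc: "G n \<subseteq> G (Suc n)" and N_Suc: "N n < N (Suc n)" and v_\<U>: "{x. E (v n) x} \<inter> G n \<in> \<U> n"
    and \<U>_Suc: "V \<in> \<U> (Suc n) \<Longrightarrow> V \<inter> G n \<in> \<U> n"
    and two: "\<exists>V0 V1. \<forall>V\<in>\<U> (Suc n). V \<inter> G n = U \<longrightarrow> V = V0 \<or> V = V1" for n V U
    using ext[of n] unfolding extends_def by blast+
  have F_mono: "F m \<subseteq> F n" if "m \<le> n" for m n
    using _ that by (rule lift_Suc_mono_le) (use v(2) in blast)
  have N_mono: "N m \<le> N n" if "m \<le> n" for m n
    using _ that by (rule lift_Suc_mono_le) (use N_Suc in \<open>simp add: less_imp_le\<close>)
  have N_ge: "n \<le> N n" for n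
  proof (induction n)
    case (Suc n)
    then show ?case using N_Suc[of n] by simp
  qed simp
  have \<U>_down: "Z \<inter> G m \<in> \<U> m" if "m \<le> n" "Z \<inter> G n \<in> \<U> n" for m n Z
    using that
  proof (induction rule: inc_induct)
    case (step k)
    then have "Z \<inter> G (Suc k) \<inter> G k \<in> \<U> k" using \<U>_Suc by blast
    moreover have "Z \<inter> G (Suc k) \<inter> G k = Z \<inter> G k" using G_Suc by blast
    ultimately show ?case by simp
  qed
  define B where "B = (\<Union>n. F n)"
  \<comment> \<open>Because of \<open>k \<le> N n\<close>, such a node depends only on the kept
    trace of \<open>Z\<close> on \<open>G n\<close>.\<close>
  define T where "T = {t. \<exists>Z k n. t = map (f Z) [0..<k] \<and> k \<le> N n \<and> Z \<inter> G n \<in> \<U> n}"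
  have "rado_graph B E" unfolding B_def
    by (rule rado_Union[OF A e]) (use FG v in blast)+
  moreover have "B \<subseteq> A" unfolding B_def using FG by blast
  moreover have "binary_subtree T"
  proof (rule binary_subtreeI)
    fix r t assume "t \<in> T" "prefix r t"
    then obtain Z k n where t: "t = map (f Z) [0..<k]" "k \<le> N n" "Z \<inter> G n \<in> \<U> n"
      unfolding T_def by blast
    have "r = take (length r) t" using \<open>prefix r t\<close> by (auto simp: prefix_def)
    moreover have "length r \<le> k" using prefix_length_le[OF \<open>prefix r t\<close>] t(1) by simp
    ultimately have "r = map (f Z) [0..<length r]" by (simp add: t(1) take_map take_upt)
    then show "r \<in> T" using t \<open>length r \<le> k\<close> unfolding T_def by (blast intro: order_trans)
  next
    fix t a b c assume abc: "t @ [a] \<in> T" "t @ [b] \<in> T" "t @ [c] \<in> T"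
    define k where "k = length t"
    \<comment> \<open>The first stage whose number of values exceeds \<open>k\<close>. At the
      preceding stage \<open>n\<close>, the first \<open>N n \<le> k\<close> values already fix the
      kept type; at most two kept types extend it at stage \<open>m\<close>, and each of them
      determines the value at \<open>k\<close>.\<close>
    define m where "m = (LEAST m. k < N m)"
    have "k < N (Suc k)" using N_ge[of "Suc k"] by simp
    then have m: "k < N m" "\<And>i. k < N i \<Longrightarrow> m \<le> i"
      unfolding m_def by (auto intro: LeastI Least_le)
    then obtain n where n: "m = Suc n" using init(2) by (cases m) auto
    then have nk: "N n \<le> k" using m(2)[of n] by force
    have child: "\<exists>Z. Z \<inter> G (Suc n) \<in> \<U> (Suc n) \<and> (\<forall>i<k. f Z i = t ! i) \<and> f Z k = x"
      if tx: "t @ [x] \<in> T" for x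
    proof -
      obtain Z l i where Z: "t @ [x] = map (f Z) [0..<l]" "l \<le> N i" "Z \<inter> G i \<in> \<U> i"
        using tx unfolding T_def by blast
      have l: "l = Suc k" using arg_cong[OF Z(1), of length] by (simp add: k_def)
      then have "m \<le> i" using m(2) Z(2) by simp
      then have "Z \<inter> G (Suc n) \<in> \<U> (Suc n)" using \<U>_down Z(3) n by blast
      moreover have "t = map (f Z) [0..<k]" "x = f Z k" using Z(1) l by simp_all
      ultimately show ?thesis by (intro exI[of _ Z]) (simp add: nth_map_upt)
    qed
    obtain Za where Za: "Za \<inter> G (Suc n) \<in> \<U> (Suc n)" "\<forall>i<k. f Za i = t ! i" "f Za k = a"
      using child[OF abc(1)] by blast
    have *: "Z \<inter> G n = Za \<inter> G n" if "Z \<inter> G (Suc n) \<in> \<U> (Suc n)" "\<forall>i<k. f Z i = t ! i" for Z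
      using that Za nk by (intro \<U>_eq) (auto intro: \<U>_down[of n "Suc n"])
    from two[of n "Za \<inter> G n"] obtain V0 V1
      where V01: "\<forall>V\<in>\<U> (Suc n). V \<inter> G n = Za \<inter> G n \<longrightarrow> V = V0 \<or> V = V1" by (elim exE)
    have "\<exists>Z. f Z k = x \<and> (Z \<inter> G m = V0 \<or> Z \<inter> G m = V1)" if tx: "t @ [x] \<in> T" for x
    proof -
      obtain Z where Z: "Z \<inter> G (Suc n) \<in> \<U> (Suc n)" "\<forall>i<k. f Z i = t ! i" "f Z k = x"
        using child[OF tx] by blast
      have "Z \<inter> G (Suc n) \<inter> G n = Za \<inter> G n" using *[OF Z(1,2)] G_Suc[of n] by blast
      then show ?thesis using V01[rule_format, OF Z(1)] Z(3) n by blast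
    qed
    moreover have "f Z k = f Z' k" if "Z \<inter> G m = Z' \<inter> G m" for Z Z'
      by (rule f_cong_superset[OF supp_G[OF m(1)] that])
    ultimately show "a = b \<or> b = c \<or> a = c" using abc by metis
  qed
  moreover have read: "map (f {x. E w x}) [0..<n] \<in> T" if w: "w \<in> B - G n" for n w
  proof -
    \<comment> \<open>The least stage identifies \<open>w\<close> as some \<open>v i\<close>. As
      \<open>F n \<subseteq> G n\<close> and \<open>w\<close> is outside \<open>G n\<close>, it was
      not added before step \<open>n\<close>.\<close>
    define m where "m = (LEAST m. w \<in> F m)"
    have m: "w \<in> F m" "\<And>i. w \<in> F i \<Longrightarrow> m \<le> i"
      unfolding m_def using w by (auto simp: B_def intro: LeastI Least_le)
    then obtain i where i: "m = Suc i" using init(1) by (cases m) auto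
    then have "w \<notin> F i" using m(2)[of i] by auto
    then have "w = v i" using m(1) i v(2) by auto
    have "n \<le> i"
    proof (rule ccontr)
      assume "\<not> n \<le> i"
      then have "F m \<subseteq> F n" using i by (intro F_mono) simp
      then show False using m(1) w FG(1)[of n] by blast
    qed
    then have "{x. E w x} \<inter> G n \<in> \<U> n" using \<U>_down[of n i] v_\<U>[of i] \<open>w = v i\<close> by blast
    then show ?thesis using N_ge unfolding T_def by blast
  qed
  moreover have "\<exists>G. finite G \<and> (\<forall>k<n. supp k \<subseteq> G) \<and> (\<forall>v\<in>B - G. map (f {x. E v x}) [0..<n] \<in> T)" for n
    using FG(3)[of n] read[of _ n] supp_G[of _ n] N_ge[of n] by (intro exI[of _ "G n"]) auto
  ultimately show ?thesis by (intro exI[of _ B] exI[of _ T]) simp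
qed

end

text \<open>The combinatorial core: \<open>dec n b C\<close> stands for \<open>C\<close> forcing the
  \<open>n\<close>-th value of the function to be \<open>b\<close>. Continuous reading turns the
  function into a map \<open>f\<close> on types. The tree is a single branch or comes from
  \<open>two_branching\<close>, and \<open>rado_homogeneous\<close> shrinks any \<open>C\<close> to
  a subcopy of one type, which decides the first \<open>n\<close> values along a node.\<close>

theorem rado_two_localization:
  fixes dec :: "nat \<Rightarrow> nat \<Rightarrow> 'a set \<Rightarrow> bool"
  assumes A: "rado_graph A E"
    and dense: "\<And>n B. rado_graph B E \<Longrightarrow> B \<subseteq> A \<Longrightarrow> \<exists>C\<subseteq>B. rado_graph C E \<and> (\<exists>b. dec n b C)"
    and mono: "\<And>n b B C. dec n b B \<Longrightarrow> C \<subseteq> B \<Longrightarrow> rado_graph C E \<Longrightarrow> dec n b C"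
  shows "\<exists>B\<subseteq>A. rado_graph B E \<and> (\<exists>T. binary_subtree T \<and>
    (\<forall>n C. rado_graph C E \<longrightarrow> C \<subseteq> B \<longrightarrow>
      (\<exists>D\<subseteq>C. rado_graph D E \<and> (\<exists>t\<in>T. length t = n \<and> (\<forall>k<n. dec k (t ! k) D)))))"
proof -
  have "\<exists>B\<subseteq>A. rado_graph B E \<and> (\<forall>n. \<exists>F. finite F \<and> F \<subseteq> B \<and> (\<forall>Z. \<exists>b. dec n b (piece E B F Z)))"
    by (rule rado_continuous_reading[OF A]) (use dense mono in blast)+
  then obtain B where B: "B \<subseteq> A" "rado_graph B E"
      "\<forall>n. \<exists>F. finite F \<and> F \<subseteq> B \<and> (\<forall>Z. \<exists>b. dec n b (piece E B F Z))" by blast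
  then obtain supp where supp: "\<And>n. finite (supp n)" "\<And>n. supp n \<subseteq> B"
      "\<And>n Z. \<exists>b. dec n b (piece E B (supp n) Z)" by metis
  \<comment> \<open>The choice is made from the piece, which depends on \<open>Z\<close> only
    through its trace on \<open>supp n\<close>; this makes \<open>f\<close> continuous.\<close>
  define f where "f Z n = (SOME b. dec n b (piece E B (supp n) Z))" for Z n
  have f: "dec n (f Z n) (piece E B (supp n) Z)" for n Z
    unfolding f_def using supp(3) by (rule someI_ex)
  have f_cong: "f Z n = f Z' n" if "Z \<inter> supp n = Z' \<inter> supp n" for Z Z' n
  proof -
    have "piece E B (supp n) Z = piece E B (supp n) Z'" using that unfolding piece_def by blast
    then show ?thesis by (simp add: f_def)
  qed
  have dec_f: "dec k (f Z k) D" if D: "rado_graph D E" "D \<subseteq> piece E B G Z" and "supp k \<subseteq> G" for D G Z k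
    using mono[OF f _ D(1)] D(2) piece_mono[OF order_refl \<open>supp k \<subseteq> G\<close>, of Z Z E B] by blast
  show ?thesis
  \<comment> \<open>If \<open>f\<close> is constant on a basic open set, passing to the
    corresponding piece makes the function equal to \<open>h\<close>, and the initial segments of
    \<open>h\<close> suffice.\<close>
  proof (cases "\<exists>G U h. finite G \<and> G \<subseteq> B \<and> (\<forall>Z. Z \<inter> G = U \<inter> G \<longrightarrow> f Z = h)")
    case True
    then obtain G U h where G: "finite G" "G \<subseteq> B" and h: "\<forall>Z. Z \<inter> G = U \<inter> G \<longrightarrow> f Z = h"
      by (elim exE conjE)
    let ?B = "piece E B G U"
    define T where "T = {map h [0..<n] |n. True}"
    have "binary_subtree T"
    proof (rule binary_subtreeI)
      fix r t assume "t \<in> T" "prefix r t"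
      then obtain n where t: "t = map h [0..<n]" unfolding T_def by blast
      have "r = take (length r) t" using \<open>prefix r t\<close> by (auto simp: prefix_def)
      moreover have "length r \<le> n" using prefix_length_le[OF \<open>prefix r t\<close>] t by simp
      ultimately have "r = map h [0..<length r]" by (simp add: t take_map take_upt)
      then show "r \<in> T" unfolding T_def by blast
    next
      fix t a b c assume "t @ [a] \<in> T" "t @ [b] \<in> T"
      moreover have "x = h (length t)" if "t @ [x] \<in> T" for x
      proof -
        obtain n where n: "t @ [x] = map h [0..<n]" using \<open>t @ [x] \<in> T\<close> unfolding T_def by blast
        have "n = Suc (length t)" using arg_cong[OF n, of length] by simp
        then show ?thesis using n by simp
      qed
      ultimately show "a = b \<or> b = c \<or> a = c" by metis
    qed
    moreover have "\<exists>D\<subseteq>C. rado_graph D E \<and> (\<exists>t\<in>T. length t = n \<and> (\<forall>k<n. dec k (t ! k) D))"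
      if C: "rado_graph C E" "C \<subseteq> ?B" for n C
    proof -
      have "finite (G \<union> (\<Union>k<n. supp k))" using G(1) supp(1) by blast
      then obtain D Z where D: "rado_graph D E" "D \<subseteq> piece E C (G \<union> (\<Union>k<n. supp k)) Z"
        using rado_homogeneous[OF C(1)] by meson
      have "C \<subseteq> B" using C(2) piece_subset by (rule order_trans)
      from \<open>C \<subseteq> B\<close> have DB: "D \<subseteq> piece E B (G \<union> (\<Union>k<n. supp k)) Z"
        by (rule order_trans[OF D(2) piece_mono[OF _ order_refl refl]])
      have DC: "D \<subseteq> C" using D(2) piece_subset by (rule order_trans)
      \<comment> \<open>One vertex lying in both pieces shows that \<open>Z\<close> and
        \<open>U\<close> agree on \<open>G\<close>.\<close>
      obtain w where "w \<in> D" using rado_infinite[OF D(1)] by fastforce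
      then have "w \<in> ?B" "w \<in> piece E B (G \<union> (\<Union>k<n. supp k)) Z" using DC C(2) DB by blast+
      then have "Z \<inter> G = U \<inter> G" unfolding piece_def by blast
      then have "f Z = h" by (rule h[rule_format])
      have "dec k (h k) D" if "k < n" for k
        using dec_f[OF D(1) DB, of k] that \<open>f Z = h\<close> by auto
      then have "length (map h [0..<n]) = n \<and> (\<forall>k<n. dec k (map h [0..<n] ! k) D)" by simp
      moreover have "map h [0..<n] \<in> T" unfolding T_def by blast
      ultimately show ?thesis using D(1) DC by blast
    qed
    moreover have "?B \<subseteq> A" using piece_subset B(1) by (rule order_trans)
    moreover have "rado_graph ?B E" by (rule rado_piece[OF B(2) G])
    ultimately show ?thesis 
      by - (rule exI[of _ ?B], intro conjI, assumption+, rule exI[of _ T], simp)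
  next
    case False
    interpret nonconstant_reading B E f supp
    proof
      show "f Z n = f Z' n" if "Z \<inter> supp n = Z' \<inter> supp n" for Z Z' n using f_cong that .
      show "\<exists>Z. Z \<inter> G = U \<inter> G \<and> f Z \<noteq> h" if "finite G" "G \<subseteq> B" for G U h
      proof (rule ccontr)
        assume "\<not> ?thesis"
        then have "\<forall>Z. Z \<inter> G = U \<inter> G \<longrightarrow> f Z = h" by simp
        with that have "\<exists>G U h. finite G \<and> G \<subseteq> B \<and> (\<forall>Z. Z \<inter> G = U \<inter> G \<longrightarrow> f Z = h)"
          by - (rule exI[of _ G], rule exI[of _ U], rule exI[of _ h], intro conjI)
        with False show False by (rule notE)
      qed
    qed (use B(2) supp in auto)
    obtain C T where C: "C \<subseteq> B" "rado_graph C E" and T: "binary_subtree T"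
      and read: "\<forall>n. \<exists>G. finite G \<and> (\<forall>k<n. supp k \<subseteq> G) \<and> (\<forall>v\<in>C - G. map (f {x. E v x}) [0..<n] \<in> T)"
      using two_branching by (elim exE conjE)
    have "\<exists>D\<subseteq>C'. rado_graph D E \<and> (\<exists>t\<in>T. length t = n \<and> (\<forall>k<n. dec k (t ! k) D))"
      if C': "rado_graph C' E" "C' \<subseteq> C" for n C'
    proof -
      obtain G where G: "finite G" "\<And>k. k < n \<Longrightarrow> supp k \<subseteq> G"
        "\<And>v. v \<in> C - G \<Longrightarrow> map (f {x. E v x}) [0..<n] \<in> T" using read by meson
      obtain D Z where D: "rado_graph D E" "D \<subseteq> piece E C' G Z"
        using rado_homogeneous[OF C'(1) G(1)] by meson
      \<comment> \<open>All of \<open>D\<close> has one type over \<open>G\<close>, so the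
        neighbourhood of any \<open>w\<close> in \<open>D\<close> can replace \<open>Z\<close>;
        since \<open>w\<close> is outside \<open>G\<close>, the values read at \<open>w\<close> form
        a node of \<open>T\<close>.\<close>
      obtain w where w: "w \<in> D" using rado_infinite[OF D(1)] by fastforce
      then have "w \<in> piece E C' G Z" using D(2) by blast
      then have "w \<in> C - G" and Z: "Z \<inter> G = {x. E w x} \<inter> G"
        using C'(2) unfolding piece_def by blast+
      then have "map (f {x. E w x}) [0..<n] \<in> T" using G(3) by blast
      moreover have "dec k (f {x. E w x} k) D" if "k < n" for k
      proof -
        have "C' \<subseteq> B" using C' C by blast
        then have "D \<subseteq> piece E B G {x. E w x}"
          using D(2) piece_mono[OF _ order_refl Z, of C' B E] by blast
        then show ?thesis using dec_f[OF D(1)] G(2)[OF that] by blast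
      qed
      moreover have "D \<subseteq> C'" using D(2) piece_subset by (rule order_trans)
      ultimately show ?thesis using D(1)
        by (intro exI[of _ D] conjI bexI[of _ "map (f {x. E w x}) [0..<n]"]) auto
    qed
    moreover have "C \<subseteq> A" using C(1) B(1) by blast
    ultimately show ?thesis using C(2) T
      by - (rule exI[of _ C], intro conjI, assumption+, rule exI[of _ T], simp)
  qed
qed

section \<open>Forcing\<close>

locale forcing =
  fixes P :: "'p set" and le :: "'p \<Rightarrow> 'p \<Rightarrow> bool"  (infix "\<sqsubseteq>" 50)
  assumes le_refl: "p \<in> P \<Longrightarrow> p \<sqsubseteq> p"
    and le_trans: "p \<sqsubseteq> q \<Longrightarrow> q \<sqsubseteq> r \<Longrightarrow> p \<sqsubseteq> r"
begin

abbreviation "dense \<equiv> dense_below P (\<sqsubseteq>)"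
abbreviation "feq \<equiv> forces_eq P (\<sqsubseteq>)"
abbreviation "fmem \<equiv> forces_mem P (\<sqsubseteq>)"
abbreviation "ents \<equiv> entries P"

section \<open>Laws of forced equality and membership\<close>

lemma denseD: "dense D p \<Longrightarrow> q \<in> P \<Longrightarrow> q \<sqsubseteq> p \<Longrightarrow> \<exists>q'\<in>P. q' \<sqsubseteq> q \<and> D q'"
  unfolding dense_below_def by blast

lemma denseI_self: "(\<And>q. q \<in> P \<Longrightarrow> q \<sqsubseteq> p \<Longrightarrow> D q) \<Longrightarrow> dense D p"
  unfolding dense_below_def using le_refl by blast

lemma dense_antimono: "dense D p \<Longrightarrow> q \<sqsubseteq> p \<Longrightarrow> dense D q"
  unfolding dense_below_def using le_trans by blast

lemma forces_eq_antimono: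
  assumes "feq \<sigma> \<tau> p" "q \<sqsubseteq> p" shows "feq \<sigma> \<tau> q"
  using assms(1)
proof cases
  case 1
  then show ?thesis using assms(2) by (intro forces_eq.intros) (blast intro: le_trans)+
qed

lemma forces_mem_antimono: "fmem \<sigma> \<tau> p \<Longrightarrow> q \<sqsubseteq> p \<Longrightarrow> fmem \<sigma> \<tau> q"
  unfolding forces_mem_def by (rule dense_antimono)

lemma forces_eqD:
  assumes "feq \<sigma> \<tau> p" "(\<pi>, r) \<in> ents \<sigma>" "q \<in> P" "q \<sqsubseteq> p" "q \<sqsubseteq> r"
  shows "dense (\<lambda>q'. \<exists>\<rho> s. (\<rho>, s) \<in> ents \<tau> \<and> q' \<sqsubseteq> s \<and> feq \<pi> \<rho> q') q"
  using assms(1) by cases (use assms in blast)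

text \<open>Datatype induction descends through the nested function, option and product types; this
  version descends through \<open>entries\<close>, as \<open>forces_eq\<close> does.\<close>

lemma pname_induct:
  assumes "\<And>\<sigma>. (\<And>\<pi> r. (\<pi>, r) \<in> ents \<sigma> \<Longrightarrow> Q \<pi>) \<Longrightarrow> Q \<sigma>"
  shows "Q \<sigma>"
proof (induction \<sigma>)
  case (PName f)
  show ?case
  proof (rule assms)
    fix \<pi> r assume "(\<pi>, r) \<in> ents (PName f)"
    then obtain i A where i: "f i = Some (\<pi>, A)" by auto
    then have "Some (\<pi>, A) \<in> range f" by (metis rangeI)
    from PName[OF this, of "(\<pi>, A)" \<pi>] show "Q \<pi>" by (simp add: fsts.simps)
  qed
qed

lemma forces_eq_refl: "feq \<sigma> \<sigma> p"
proof (induction \<sigma> arbitrary: p rule: pname_induct)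
  case (1 \<sigma>)
  show ?case
    by (rule forces_eq.intros; rule denseI_self) (use 1 le_trans in blast)+
qed

lemma forces_eq_sym: "feq \<sigma> \<tau> p \<Longrightarrow> feq \<tau> \<sigma> p"
proof (induction rule: forces_eq.induct)
  case (1 \<sigma> p \<tau>)
  show ?case
    by (rule forces_eq.intros) (use 1 in \<open>fastforce simp: dense_below_def\<close>)+
qed

lemma forces_eqD1:
  assumes "feq \<sigma> \<tau> p" "(\<pi>, r) \<in> ents \<sigma>" "q \<in> P" "q \<sqsubseteq> p" "q \<sqsubseteq> r"
  shows "\<exists>q'\<in>P. q' \<sqsubseteq> q \<and> (\<exists>\<rho> s. (\<rho>, s) \<in> ents \<tau> \<and> q' \<sqsubseteq> s \<and> feq \<pi> \<rho> q')"
  using denseD[OF forces_eqD[OF assms] assms(3) le_refl[OF assms(3)]] .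

lemma forces_eqD2:
  assumes "feq \<sigma> \<tau> p" "(\<rho>, s) \<in> ents \<tau>" "q \<in> P" "q \<sqsubseteq> p" "q \<sqsubseteq> s"
  shows "\<exists>q'\<in>P. q' \<sqsubseteq> q \<and> (\<exists>\<pi> r. (\<pi>, r) \<in> ents \<sigma> \<and> q' \<sqsubseteq> r \<and> feq \<pi> \<rho> q')"
  using forces_eqD1[OF forces_eq_sym[OF assms(1)] assms(2-)] forces_eq_sym by blast

text \<open>Both clauses pass through an entry of \<open>\<tau>\<close>, and in either direction the
  chain of equalities ends at an entry of \<open>\<sigma>\<close>. Induction on
  \<open>\<sigma>\<close> alone therefore suffices, with the other names arbitrary.\<close>

lemma forces_eq_trans: "feq \<sigma> \<tau> p \<Longrightarrow> feq \<tau> \<upsilon> p \<Longrightarrow> feq \<sigma> \<upsilon> p"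
proof (induction \<sigma> arbitrary: \<tau> \<upsilon> p rule: pname_induct)
  case (1 \<sigma>)
  show ?case
  proof (rule forces_eq.intros)
    fix \<pi> r q assume q: "(\<pi>, r) \<in> ents \<sigma>" "q \<in> P" "q \<sqsubseteq> p" "q \<sqsubseteq> r"
    show "dense (\<lambda>q'. \<exists>\<rho> s. (\<rho>, s) \<in> ents \<upsilon> \<and> q' \<sqsubseteq> s \<and> feq \<pi> \<rho> q') q"
      unfolding dense_below_def
    proof (intro ballI impI)
      fix u assume u: "u \<in> P" "u \<sqsubseteq> q"
      obtain u1 \<rho> s where u1: "u1 \<in> P" "u1 \<sqsubseteq> u" "(\<rho>, s) \<in> ents \<tau>" "u1 \<sqsubseteq> s" "feq \<pi> \<rho> u1"
        using forces_eqD1[OF "1.prems"(1) q(1) u(1)] q u le_trans by meson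
      obtain u2 \<eta> w where u2: "u2 \<in> P" "u2 \<sqsubseteq> u1" "(\<eta>, w) \<in> ents \<upsilon>" "u2 \<sqsubseteq> w" "feq \<rho> \<eta> u2"
        using forces_eqD1[OF "1.prems"(2) u1(3,1)] q u u1 le_trans by meson
      have "feq \<pi> \<eta> u2" using "1.IH"[OF q(1)] forces_eq_antimono u1(5) u2(2,5) by blast
      then show "\<exists>q'\<in>P. q' \<sqsubseteq> u \<and> (\<exists>\<rho> s. (\<rho>, s) \<in> ents \<upsilon> \<and> q' \<sqsubseteq> s \<and> feq \<pi> \<rho> q')"
        using u1 u2 le_trans by blast
    qed
  next
    fix \<eta> w q assume q: "(\<eta>, w) \<in> ents \<upsilon>" "q \<in> P" "q \<sqsubseteq> p" "q \<sqsubseteq> w"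
    show "dense (\<lambda>q'. \<exists>\<pi> r. (\<pi>, r) \<in> ents \<sigma> \<and> q' \<sqsubseteq> r \<and> feq \<pi> \<eta> q') q"
      unfolding dense_below_def
    proof (intro ballI impI)
      fix u assume u: "u \<in> P" "u \<sqsubseteq> q"
      obtain u1 \<rho> s where u1: "u1 \<in> P" "u1 \<sqsubseteq> u" "(\<rho>, s) \<in> ents \<tau>" "u1 \<sqsubseteq> s" "feq \<rho> \<eta> u1"
        using forces_eqD2[OF "1.prems"(2) q(1) u(1)] q u le_trans by meson
      obtain u2 \<pi> r where u2: "u2 \<in> P" "u2 \<sqsubseteq> u1" "(\<pi>, r) \<in> ents \<sigma>" "u2 \<sqsubseteq> r" "feq \<pi> \<rho> u2"
        using forces_eqD2[OF "1.prems"(1) u1(3,1)] q u u1 le_trans by meson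
      have "feq \<pi> \<eta> u2" using "1.IH"[OF u2(3)] forces_eq_antimono u1(5) u2(2,5) by blast
      then show "\<exists>q'\<in>P. q' \<sqsubseteq> u \<and> (\<exists>\<pi> r. (\<pi>, r) \<in> ents \<sigma> \<and> q' \<sqsubseteq> r \<and> feq \<pi> \<eta> q')"
        using u1 u2 le_trans by blast
    qed
  qed
qed

lemma forces_memD:
  assumes "fmem \<pi> \<tau> p" "q \<in> P" "q \<sqsubseteq> p"
  obtains q' \<rho> s where "q' \<in> P" "q' \<sqsubseteq> q" "(\<rho>, s) \<in> ents \<tau>" "q' \<sqsubseteq> s" "feq \<pi> \<rho> q'"
  using denseD[OF assms(1)[unfolded forces_mem_def] assms(2,3)] by blast

lemma forces_memI: "(\<rho>, s) \<in> ents \<tau> \<Longrightarrow> p \<sqsubseteq> s \<Longrightarrow> feq \<pi> \<rho> p \<Longrightarrow> fmem \<pi> \<tau> p"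
  unfolding forces_mem_def by (rule denseI_self) (use forces_eq_antimono le_trans in blast)

lemma forces_mem_cong_left:
  assumes "feq \<pi> \<pi>' p" "fmem \<pi> \<tau> p" shows "fmem \<pi>' \<tau> p"
  unfolding forces_mem_def
proof (unfold dense_below_def, intro ballI impI)
  fix q assume q: "q \<in> P" "q \<sqsubseteq> p"
  obtain q' \<rho> s where q': "q' \<in> P" "q' \<sqsubseteq> q" "(\<rho>, s) \<in> ents \<tau>" "q' \<sqsubseteq> s" "feq \<pi> \<rho> q'"
    using forces_memD[OF assms(2) q] by blast
  moreover have "feq \<pi>' \<pi> q'" using assms(1) q q' by (meson forces_eq_sym forces_eq_antimono le_trans)
  ultimately show "\<exists>q'\<in>P. q' \<sqsubseteq> q \<and> (\<exists>\<rho> s. (\<rho>, s) \<in> ents \<tau> \<and> q' \<sqsubseteq> s \<and> feq \<pi>' \<rho> q')"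
    using forces_eq_trans by blast
qed

lemma forces_mem_cong_right:
  assumes "feq \<tau> \<tau>' p" "fmem \<pi> \<tau> p" shows "fmem \<pi> \<tau>' p"
  unfolding forces_mem_def
proof (unfold dense_below_def, intro ballI impI)
  fix q assume q: "q \<in> P" "q \<sqsubseteq> p"
  obtain q1 \<rho> s where q1: "q1 \<in> P" "q1 \<sqsubseteq> q" "(\<rho>, s) \<in> ents \<tau>" "q1 \<sqsubseteq> s" "feq \<pi> \<rho> q1"
    using forces_memD[OF assms(2) q] by blast
  obtain q2 \<eta> t where q2: "q2 \<in> P" "q2 \<sqsubseteq> q1" "(\<eta>, t) \<in> ents \<tau>'" "q2 \<sqsubseteq> t" "feq \<rho> \<eta> q2"
    using forces_eqD1[OF assms(1) q1(3,1)] q q1 le_trans by meson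
  have "feq \<pi> \<eta> q2" using q1 q2 forces_eq_trans forces_eq_antimono by blast
  then show "\<exists>q'\<in>P. q' \<sqsubseteq> q \<and> (\<exists>\<rho> s. (\<rho>, s) \<in> ents \<tau>' \<and> q' \<sqsubseteq> s \<and> feq \<pi> \<rho> q')"
    using q1 q2 le_trans by blast
qed

section \<open>Names of countable ground-model sets, numerals and pairs\<close>

lemma forces_mem_set_nameI:
  assumes "countable S" "\<rho> \<in> S" "p \<in> P" "feq \<pi> \<rho> p"
  shows "fmem \<pi> (set_name S) p"
  by (rule forces_memI[of \<rho> p]) (use assms in \<open>auto simp: entries_set_name le_refl\<close>)

lemma forces_mem_set_nameD:
  assumes "countable S" "fmem \<pi> (set_name S) p" "q \<in> P" "q \<sqsubseteq> p"
  obtains q' \<rho> where "q' \<in> P" "q' \<sqsubseteq> q" "\<rho> \<in> S" "feq \<pi> \<rho> q'"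
proof -
  obtain q' \<rho> s where "q' \<in> P" "q' \<sqsubseteq> q" "(\<rho>, s) \<in> ents (set_name S)" "feq \<pi> \<rho> q'"
    using forces_memD[OF assms(2-4)] by blast
  with that show ?thesis by (auto simp: entries_set_name[OF assms(1)])
qed

lemma forces_eq_set_name:
  assumes "countable S" "countable S'" "p \<in> P"
  shows "feq (set_name S) (set_name S') p \<longleftrightarrow>
    (\<forall>\<pi>\<in>S. fmem \<pi> (set_name S') p) \<and> (\<forall>\<rho>\<in>S'. fmem \<rho> (set_name S) p)" (is "?l \<longleftrightarrow> ?r")
proof
  assume ?l
  then show ?r
    using assms forces_mem_cong_right forces_mem_set_nameI forces_eq_refl forces_eq_sym by metis
next
  assume r: ?r
  show ?l
  proof (rule forces_eq.intros)
    fix \<pi> r q assume q: "(\<pi>, r) \<in> ents (set_name S)" "q \<in> P" "q \<sqsubseteq> p" "q \<sqsubseteq> r"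
    then have "\<pi> \<in> S" by (simp add: entries_set_name[OF assms(1)])
    then have "fmem \<pi> (set_name S') q" using r forces_mem_antimono[OF _ q(3)] by blast
    then show "dense (\<lambda>q'. \<exists>\<rho> s. (\<rho>, s) \<in> ents (set_name S') \<and> q' \<sqsubseteq> s \<and> feq \<pi> \<rho> q') q"
      unfolding forces_mem_def .
  next
    fix \<rho> s q assume q: "(\<rho>, s) \<in> ents (set_name S')" "q \<in> P" "q \<sqsubseteq> p" "q \<sqsubseteq> s"
    then have "\<rho> \<in> S'" by (simp add: entries_set_name[OF assms(2)])
    then have "fmem \<rho> (set_name S) q" using r forces_mem_antimono[OF _ q(3)] by blast
    then show "dense (\<lambda>q'. \<exists>\<pi> r. (\<pi>, r) \<in> ents (set_name S) \<and> q' \<sqsubseteq> r \<and> feq \<pi> \<rho> q') q"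
      unfolding forces_mem_def dense_below_def using forces_eq_sym by meson
  qed
qed

text \<open>If equality were forced, \<open>m < n\<close> would put the name of \<open>m\<close>
  into itself; a stronger condition would then force it equal to a smaller numeral, against the
  induction hypothesis.\<close>

lemma not_forces_eq_nat_name:
  assumes "m < n" "p \<in> P" shows "\<not> feq (nat_name m :: ('i, 'p) pname) (nat_name n) p"
  using assms
proof (induction m arbitrary: n p rule: less_induct)
  case (less m)
  show ?case
  proof
    let ?m = "nat_name m :: ('i, 'p) pname"
    assume eq: "feq ?m (nat_name n) p"
    have "fmem ?m (nat_name n) p"
      unfolding nat_name.simps[of n]
      by (rule forces_mem_set_nameI[of _ "nat_name m"]) (use less.prems forces_eq_refl in auto)
    then have "fmem ?m ?m p"
      by (rule forces_mem_cong_right[OF forces_eq_sym[OF eq]])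
    then have "fmem ?m (set_name (nat_name ` {..<m})) p"
      by (simp only: nat_name.simps[of m, symmetric])
    moreover have "countable (nat_name ` {..<m} :: ('i, 'p) pname set)" by (simp add: countable_finite)
    ultimately obtain q \<rho> where "q \<in> P" "\<rho> \<in> nat_name ` {..<m}" "feq ?m \<rho> q"
      using forces_mem_set_nameD[OF _ _ less.prems(2) le_refl[OF less.prems(2)]] by metis
    then show False using less.IH forces_eq_sym by blast
  qed
qed

lemma forces_eq_nat_nameD: "p \<in> P \<Longrightarrow> feq (nat_name m) (nat_name n) p \<Longrightarrow> m = n"
  using not_forces_eq_nat_name forces_eq_sym by (metis linorder_neqE_nat)

lemma forces_eq_pair_name:
  assumes "p \<in> P" "feq a a' p" "feq b b' p"
  shows "feq (pair_name a b) (pair_name a' b') p"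
proof -
  have mem: "fmem \<sigma> (set_name S) p" if "\<rho> \<in> S" "finite S" "feq \<sigma> \<rho> p" for \<sigma> \<rho> S
    using that assms(1) by (intro forces_mem_set_nameI[of S \<rho>]) (auto simp: countable_finite)
  have eq: "feq (set_name S) (set_name S') p"
    if "finite S" "finite S'" "\<forall>\<sigma>\<in>S. \<exists>\<rho>\<in>S'. feq \<sigma> \<rho> p" "\<forall>\<rho>\<in>S'. \<exists>\<sigma>\<in>S. feq \<sigma> \<rho> p" for S S'
    using that mem forces_eq_sym
    by (subst forces_eq_set_name[OF _ _ assms(1)]) (blast intro: countable_finite)+
  have "feq (set_name {a}) (set_name {a'}) p" "feq (set_name {a, b}) (set_name {a', b'}) p"
    by (rule eq; use assms in blast)+
  then show ?thesis unfolding pair_name_def by (intro eq) blast+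
qed

lemma forces_mem_omega: "p \<in> P \<Longrightarrow> fmem (nat_name n) omega_name p"
  unfolding omega_name_def by (rule forces_mem_set_nameI) (auto intro: forces_eq_refl)

lemma forces_mem_omegaD:
  assumes "fmem \<sigma> omega_name p" "q \<in> P" "q \<sqsubseteq> p"
  obtains q' n where "q' \<in> P" "q' \<sqsubseteq> q" "feq \<sigma> (nat_name n) q'"
  using forces_mem_set_nameD[OF _ assms(1)[unfolded omega_name_def] assms(2,3)] that
  by (metis countableI_type countable_image imageE)

lemma forces_mem_nat_nameD:
  assumes "fmem \<sigma> (nat_name n) p" "q \<in> P" "q \<sqsubseteq> p"
  obtains q' k where "q' \<in> P" "q' \<sqsubseteq> q" "k < n" "feq \<sigma> (nat_name k) q'"
  using forces_mem_set_nameD[OF _ assms(1)[unfolded nat_name.simps[of n]] assms(2,3)] that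
  by (metis countable_finite finite_imageI finite_lessThan imageE lessThan_iff)

lemma forces_mem_nat_name: "p \<in> P \<Longrightarrow> k < n \<Longrightarrow> fmem (nat_name k) (nat_name n) p"
  unfolding nat_name.simps[of n]
  by (rule forces_mem_set_nameI[of _ "nat_name k"]) (auto intro: forces_eq_refl)

text \<open>\<open>forces_imp\<close> is a negated conjunction, so the consequent is reached only
  below the given condition. The rules for implication and for bounded universal quantification all
  have this form.\<close>

lemma forces_impI:
  assumes "\<And>q. q \<in> P \<Longrightarrow> q \<sqsubseteq> p \<Longrightarrow> \<phi> q \<Longrightarrow> \<exists>q'\<in>P. q' \<sqsubseteq> q \<and> \<psi> q'"
  shows "forces_imp P (\<sqsubseteq>) \<phi> \<psi> p"
  using assms unfolding forces_imp_def forces_not_def forces_and_def by blast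

lemma forces_impD:
  assumes "forces_imp P (\<sqsubseteq>) \<phi> \<psi> p" "q \<in> P" "q \<sqsubseteq> p" "\<phi> q"
  shows "\<exists>q'\<in>P. q' \<sqsubseteq> q \<and> \<psi> q'"
  using assms unfolding forces_imp_def forces_not_def forces_and_def by blast

lemma forces_ballI:
  assumes "\<And>\<sigma> q. q \<in> P \<Longrightarrow> q \<sqsubseteq> p \<Longrightarrow> fmem \<sigma> \<tau> q \<Longrightarrow> \<exists>q'\<in>P. q' \<sqsubseteq> q \<and> \<phi> \<sigma> q'"
  shows "forces_ball P (\<sqsubseteq>) \<tau> \<phi> p"
  unfolding forces_ball_def forces_all_def using assms by (intro allI forces_impI)

lemma forces_ballD:
  assumes "forces_ball P (\<sqsubseteq>) \<tau> \<phi> p" "q \<in> P" "q \<sqsubseteq> p" "fmem \<sigma> \<tau> q"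
  shows "\<exists>q'\<in>P. q' \<sqsubseteq> q \<and> \<phi> \<sigma> q'"
proof -
  have "forces_imp P (\<sqsubseteq>) (fmem \<sigma> \<tau>) (\<phi> \<sigma>) p"
    using assms(1) unfolding forces_ball_def forces_all_def by (rule spec)
  then show ?thesis using assms(2-4) by (rule forces_impD)
qed

lemma forces_bexI:
  assumes "fmem \<sigma> \<tau> p" "\<And>q. q \<in> P \<Longrightarrow> q \<sqsubseteq> p \<Longrightarrow> \<phi> \<sigma> q"
  shows "forces_bex P (\<sqsubseteq>) \<tau> \<phi> p"
  unfolding forces_bex_def forces_ex_def forces_and_def
  by (rule denseI_self) (use assms forces_mem_antimono in blast)

lemma forces_bexD:
  assumes "forces_bex P (\<sqsubseteq>) \<tau> \<phi> p" "q \<in> P" "q \<sqsubseteq> p"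
  shows "\<exists>q'\<in>P. q' \<sqsubseteq> q \<and> (\<exists>\<sigma>. fmem \<sigma> \<tau> q' \<and> \<phi> \<sigma> q')"
  using denseD[OF assms(1)[unfolded forces_bex_def forces_ex_def forces_and_def] assms(2,3)] .

section \<open>Names of functions from omega to omega\<close>

definition value_at :: "('i, 'p) pname \<Rightarrow> nat \<Rightarrow> nat \<Rightarrow> 'p \<Rightarrow> bool" where
  "value_at x n m = fmem (pair_name (nat_name n) (nat_name m)) x"

lemma value_at_antimono: "value_at x n m p \<Longrightarrow> q \<sqsubseteq> p \<Longrightarrow> value_at x n m q"
  unfolding value_at_def by (rule forces_mem_antimono)

text \<open>Strengthening turns the witness \<open>\<mu>\<close> of totality at \<open>n\<close>
  into a numeral. Any other value forced there would be forced equal to that numeral further down,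
  whereas distinct numerals are never forced equal.\<close>

lemma forces_real_value:
  assumes x: "forces_real P (\<sqsubseteq>) x p" and q: "q \<in> P" "q \<sqsubseteq> p"
  obtains q' m where "q' \<in> P" "q' \<sqsubseteq> q" "value_at x n m q'"
    "\<And>m'. value_at x n m' q' \<Longrightarrow> m' = m"
proof -
  let ?n = "nat_name n"
  let ?unique = "\<lambda>m. forces_ball P (\<sqsubseteq>) omega_name (\<lambda>m'.
    forces_imp P (\<sqsubseteq>) (fmem (pair_name ?n m') x) (feq m' m))"
  have "forces_ball P (\<sqsubseteq>) omega_name (\<lambda>n. forces_bex P (\<sqsubseteq>) omega_name (\<lambda>m.
      forces_and (fmem (pair_name n m) x) (forces_ball P (\<sqsubseteq>) omega_name (\<lambda>m'.
      forces_imp P (\<sqsubseteq>) (fmem (pair_name n m') x) (feq m' m))))) p"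
    using x unfolding forces_real_def forces_and_def by blast
  from forces_ballD[OF this q forces_mem_omega[OF q(1)]] obtain q1 where
    q1: "q1 \<in> P" "q1 \<sqsubseteq> q" "forces_bex P (\<sqsubseteq>) omega_name (\<lambda>m. forces_and (fmem (pair_name ?n m) x) (?unique m)) q1"
    by blast
  from forces_bexD[OF q1(3,1) le_refl[OF q1(1)]] obtain q2 \<mu> where
    q2: "q2 \<in> P" "q2 \<sqsubseteq> q1" "fmem \<mu> omega_name q2" "fmem (pair_name ?n \<mu>) x q2" "?unique \<mu> q2"
    unfolding forces_and_def by blast
  obtain q3 m where q3: "q3 \<in> P" "q3 \<sqsubseteq> q2" "feq \<mu> (nat_name m) q3"
    using forces_mem_omegaD[OF q2(3,1) le_refl[OF q2(1)]] by metis
  have "feq (pair_name ?n \<mu>) (pair_name ?n (nat_name m)) q3"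
    using forces_eq_pair_name[OF q3(1) forces_eq_refl q3(3)] .
  then have "value_at x n m q3"
    unfolding value_at_def using forces_mem_cong_left forces_mem_antimono[OF q2(4) q3(2)] by blast
  moreover have "m' = m" if m': "value_at x n m' q3" for m'
  proof -
    from forces_ballD[OF q2(5) q3(1,2) forces_mem_omega[OF q3(1)], of m'] obtain q4 where
      q4: "q4 \<in> P" "q4 \<sqsubseteq> q3" "forces_imp P (\<sqsubseteq>) (fmem (pair_name ?n (nat_name m')) x) (feq (nat_name m') \<mu>) q4"
      by blast
    obtain q5 where q5: "q5 \<in> P" "q5 \<sqsubseteq> q4" "feq (nat_name m') \<mu> q5"
      using forces_impD[OF q4(3,1) le_refl[OF q4(1)]] value_at_antimono[OF m' q4(2)]
      unfolding value_at_def by blast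
    have "q5 \<sqsubseteq> q3" using q5(2) q4(2) by (rule le_trans)
    from forces_eq_trans[OF q5(3) forces_eq_antimono[OF q3(3) this]] show ?thesis
      using forces_eq_nat_nameD q5(1) by blast
  qed
  moreover have "q3 \<sqsubseteq> q" using q1(2) q2(2) q3(2) le_trans by blast
  ultimately show ?thesis using that q3(1) by blast
qed

lemma value_at_unique:
  assumes x: "forces_real P (\<sqsubseteq>) x p" and q: "q \<in> P" "q \<sqsubseteq> p"
    and "value_at x n m q" "value_at x n m' q"
  shows "m = m'"
proof -
  obtain q' k where "q' \<in> P" "q' \<sqsubseteq> q" "\<And>m'. value_at x n m' q' \<Longrightarrow> m' = k"
    using forces_real_value[OF x q] by metis
  then show ?thesis using assms(4,5) value_at_antimono by metis
qed

text \<open>Both inclusions are checked densely. An element of the name of \<open>t\<close> becomes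
  one of its listed pairs; a pair in \<open>x\<close> with first coordinate in \<open>\<nu>\<close>
  gets numerals as coordinates, and \<open>value_at_unique\<close> then identifies it as a pair of
  \<open>t\<close>.\<close>

lemma forces_restrict_seq_name:
  fixes x :: "('i, 'p) pname"
  assumes x: "forces_real P (\<sqsubseteq>) x p" and r: "r \<in> P" "r \<sqsubseteq> p"
    and \<nu>: "feq \<nu> (nat_name (length t)) r"
    and t: "\<And>k. k < length t \<Longrightarrow> value_at x k (t ! k) r"
  shows "forces_restrict P (\<sqsubseteq>) (seq_name t) x \<nu> r"
  unfolding forces_restrict_def forces_all_def forces_iff_def forces_and_def
proof (intro allI conjI forces_impI)
  let ?S = "(\<lambda>k. pair_name (nat_name k) (nat_name (t ! k))) ` {..<length t} :: ('i, 'p) pname set"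
  have S: "countable ?S" by (simp add: countable_finite)
  fix z q assume q: "q \<in> P" "q \<sqsubseteq> r"
  let ?\<phi> = "forces_bex P (\<sqsubseteq>) \<nu> (\<lambda>k. forces_bex P (\<sqsubseteq>) omega_name (\<lambda>m. feq z (pair_name k m)))"
  {
    assume "fmem z (seq_name t) q"
    then have z: "fmem z (set_name ?S) q" unfolding seq_name_def .
    obtain q' \<rho> where "q' \<in> P" "q' \<sqsubseteq> q" "\<rho> \<in> ?S" "feq z \<rho> q'"
      by (rule forces_mem_set_nameD[OF S z q(1) le_refl[OF q(1)]], rule that)
    then obtain k where q': "q' \<in> P" "q' \<sqsubseteq> q" "k < length t"
        "feq z (pair_name (nat_name k) (nat_name (t ! k))) q'" by blast
    have q'r: "q' \<sqsubseteq> r" using q'(2) q(2) by (rule le_trans)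
    have "fmem z x q'"
      using forces_mem_cong_left[OF forces_eq_sym[OF q'(4)]] value_at_antimono[OF t[OF q'(3)] q'r]
      unfolding value_at_def .
    moreover have "?\<phi> q'"
    proof (rule forces_bexI)
      show "fmem (nat_name k) \<nu> q'"
        using forces_mem_cong_right[OF forces_eq_sym[OF forces_eq_antimono[OF \<nu> q'r]]]
          forces_mem_nat_name[OF q'(1,3)] .
      fix u assume u: "u \<in> P" "u \<sqsubseteq> q'"
      show "forces_bex P (\<sqsubseteq>) omega_name (\<lambda>m. feq z (pair_name (nat_name k) m)) u"
        by (rule forces_bexI[OF forces_mem_omega[OF u(1)]])
          (use forces_eq_antimono[OF q'(4)] u(2) le_trans in blast)
    qed
    ultimately show "\<exists>q'\<in>P. q' \<sqsubseteq> q \<and> fmem z x q' \<and> ?\<phi> q'" using q'(1,2) by blast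
  next
    assume z: "fmem z x q \<and> ?\<phi> q"
    obtain q1 \<kappa> where q1: "q1 \<in> P" "q1 \<sqsubseteq> q" "fmem \<kappa> \<nu> q1"
        "forces_bex P (\<sqsubseteq>) omega_name (\<lambda>m. feq z (pair_name \<kappa> m)) q1"
      using forces_bexD[OF conjunct2[OF z] q(1) le_refl[OF q(1)]] by blast
    obtain q2 \<mu> where q2: "q2 \<in> P" "q2 \<sqsubseteq> q1" "fmem \<mu> omega_name q2" "feq z (pair_name \<kappa> \<mu>) q2"
      using forces_bexD[OF q1(4,1) le_refl[OF q1(1)]] by blast
    have q1r: "q1 \<sqsubseteq> r" using q1(2) q(2) by (rule le_trans)
    have "fmem \<kappa> (nat_name (length t)) q2"
      using forces_mem_cong_right[OF forces_eq_antimono[OF \<nu> q1r] q1(3)] q2(2) by (rule forces_mem_antimono)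
    then obtain q3 k where q3: "q3 \<in> P" "q3 \<sqsubseteq> q2" "k < length t" "feq \<kappa> (nat_name k) q3"
      using forces_mem_nat_nameD[OF _ q2(1) le_refl[OF q2(1)]] by metis
    obtain q4 m where q4: "q4 \<in> P" "q4 \<sqsubseteq> q3" "feq \<mu> (nat_name m) q4"
      using forces_mem_omegaD[OF q2(3) q3(1,2)] by metis
    have q4q2: "q4 \<sqsubseteq> q2" using q4(2) q3(2) by (rule le_trans)
    then have q4q: "q4 \<sqsubseteq> q" using q1(2) q2(2) le_trans by blast
    have q4r: "q4 \<sqsubseteq> r" using q4q q(2) by (rule le_trans)
    have "feq (pair_name \<kappa> \<mu>) (pair_name (nat_name k) (nat_name m)) q4"
      using forces_eq_pair_name[OF q4(1) forces_eq_antimono[OF q3(4) q4(2)] q4(3)] .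
    then have eq: "feq z (pair_name (nat_name k) (nat_name m)) q4"
      using forces_eq_trans forces_eq_antimono[OF q2(4) q4q2] by blast
    then have "value_at x k m q4"
      unfolding value_at_def using forces_mem_cong_left forces_mem_antimono[OF conjunct1[OF z] q4q] by blast
    then have "m = t ! k"
      using value_at_unique[OF x q4(1)] value_at_antimono[OF t[OF q3(3)] q4r] le_trans q4r r(2) by metis
    then have "fmem z (seq_name t) q4"
      unfolding seq_name_def using eq q3(3) q4(1)
      by (intro forces_mem_set_nameI[OF S, of "pair_name (nat_name k) (nat_name m)"]) auto
    then show "\<exists>q'\<in>P. q' \<sqsubseteq> q \<and> fmem z (seq_name t) q'" using q4(1) q4q by blast
  }
qed

text \<open>This separates names from combinatorics: \<open>comb\<close> speaks of the order alone,
  and \<open>dec\<close> is instantiated by \<open>value_at x\<close>, whose density below a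
  condition forcing \<open>forces_real x\<close> and monotonicity are already available.\<close>

theorem two_localizationI:
  assumes comb: "\<And>p dec. p \<in> P \<Longrightarrow>
      (\<And>n q. q \<in> P \<Longrightarrow> q \<sqsubseteq> p \<Longrightarrow> \<exists>r\<in>P. r \<sqsubseteq> q \<and> (\<exists>m :: nat. dec n m r)) \<Longrightarrow>
      (\<And>n m q r. dec n m q \<Longrightarrow> r \<in> P \<Longrightarrow> r \<sqsubseteq> q \<Longrightarrow> dec n m r) \<Longrightarrow>
      \<exists>q\<in>P. q \<sqsubseteq> p \<and> (\<exists>T. binary_subtree T \<and> (\<forall>n :: nat. \<forall>r\<in>P. r \<sqsubseteq> q \<longrightarrow>
        (\<exists>r'\<in>P. r' \<sqsubseteq> r \<and> (\<exists>t\<in>T. length t = n \<and> (\<forall>k<n. dec k (t ! k) r')))))"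
  shows "two_localization P (\<sqsubseteq>) TYPE('i)"
  unfolding two_localization_def forces_all_def
proof (intro ballI allI forces_impI)
  fix p0 p and x :: "('i, 'p) pname" assume p: "p \<in> P" and x: "forces_real P (\<sqsubseteq>) x p"
  let ?local = "\<lambda>T. forces_ball P (\<sqsubseteq>) omega_name (\<lambda>n :: ('i, 'p) pname. forces_bex P (\<sqsubseteq>) (tree_name T) (\<lambda>s.
      forces_restrict P (\<sqsubseteq>) s x n))"
  have "\<exists>q'\<in>P. q' \<sqsubseteq> q \<and> (\<exists>T. binary_subtree T \<and> ?local T q')" if q: "q \<in> P" "q \<sqsubseteq> p" for q
  proof -
    have "\<exists>q'\<in>P. q' \<sqsubseteq> q \<and> (\<exists>T. binary_subtree T \<and> (\<forall>n :: nat. \<forall>r\<in>P. r \<sqsubseteq> q' \<longrightarrow>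
        (\<exists>r'\<in>P. r' \<sqsubseteq> r \<and> (\<exists>t\<in>T. length t = n \<and> (\<forall>k<n. value_at x k (t ! k) r')))))"
    proof (rule comb[OF q(1)])
      show "\<exists>r'\<in>P. r' \<sqsubseteq> r \<and> (\<exists>m. value_at x n m r')" if r: "r \<in> P" "r \<sqsubseteq> q" for n r
        using forces_real_value[OF x r(1) le_trans[OF r(2) q(2)]] by metis
      show "value_at x n m r" if "value_at x n m q" "r \<in> P" "r \<sqsubseteq> q" for n m q r
        using that value_at_antimono by blast
    qed
    then obtain q' T where q': "q' \<in> P" "q' \<sqsubseteq> q" and T: "binary_subtree T"
      and read: "\<And>n r. r \<in> P \<Longrightarrow> r \<sqsubseteq> q' \<Longrightarrow>
        \<exists>r'\<in>P. r' \<sqsubseteq> r \<and> (\<exists>t\<in>T. length t = n \<and> (\<forall>k<n. value_at x k (t ! k) r'))" by blast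
    have "?local T q'"
    proof (rule forces_ballI)
      fix \<nu> :: "('i, 'p) pname" and r assume r: "r \<in> P" "r \<sqsubseteq> q'" "fmem \<nu> omega_name r"
      \<comment> \<open>\<open>\<nu>\<close> is only a name of a natural number; a stronger
        condition decides which one, and \<open>read\<close> is applied to it.\<close>
      obtain r1 n where r1: "r1 \<in> P" "r1 \<sqsubseteq> r" "feq \<nu> (nat_name n) r1"
        using forces_mem_omegaD[OF r(3,1) le_refl[OF r(1)]] by metis
      obtain r2 t where r2: "r2 \<in> P" "r2 \<sqsubseteq> r1" "t \<in> T" "length t = n"
          "\<And>k. k < n \<Longrightarrow> value_at x k (t ! k) r2"
        using read[OF r1(1) le_trans[OF r1(2) r(2)], of n] by blast
      have "forces_bex P (\<sqsubseteq>) (tree_name T) (\<lambda>s. forces_restrict P (\<sqsubseteq>) s x \<nu>) r2"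
      proof (rule forces_bexI)
        show "fmem (seq_name t) (tree_name T) r2"
          unfolding tree_name_def
          by (rule forces_mem_set_nameI[of _ "seq_name t"]) (use r2 forces_eq_refl in auto)
        fix u assume u: "u \<in> P" "u \<sqsubseteq> r2"
        show "forces_restrict P (\<sqsubseteq>) (seq_name t) x \<nu> u"
        proof (rule forces_restrict_seq_name[OF x u(1)])
          show "u \<sqsubseteq> p" using u r2 r1 r q' q le_trans by meson
          show "feq \<nu> (nat_name (length t)) u"
            using forces_eq_antimono[OF r1(3)] le_trans[OF u(2) r2(2)] r2(4) by blast
          show "value_at x k (t ! k) u" if "k < length t" for k
            using value_at_antimono[OF r2(5) u(2)] that r2(4) by blast
        qed
      qed
      then show "\<exists>r'\<in>P. r' \<sqsubseteq> r \<and> forces_bex P (\<sqsubseteq>) (tree_name T) (\<lambda>s. forces_restrict P (\<sqsubseteq>) s x \<nu>) r'"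
        using r2(1) le_trans[OF r2(2) r1(2)] by blast
    qed
    with q' T show ?thesis by blast
  qed
  then have "forces_ex P (\<sqsubseteq>) (\<lambda>T q. binary_subtree T \<and> ?local T q) p"
    unfolding forces_ex_def dense_below_def by blast
  then show "\<exists>q'\<in>P. q' \<sqsubseteq> p \<and> forces_ex P (\<sqsubseteq>) (\<lambda>T q. binary_subtree T \<and> ?local T q) q'"
    using p le_refl by blast
qed

end

section \<open>The 2-localization property\<close>

theorem theorem3p3:
  fixes R :: "'a set" and E :: "'a \<Rightarrow> 'a \<Rightarrow> bool"
  assumes "rado_graph R E"
  shows "two_localization (copies R E) (\<subseteq>) TYPE('i)"
proof -
  interpret forcing "copies R E" "(\<subseteq>)" by standard auto
  have copy: "B \<in> copies R E \<longleftrightarrow> B \<subseteq> R \<and> rado_graph B E" for B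
    using copies_eq[OF assms] by simp
  show ?thesis
  proof (rule two_localizationI)
    fix A and dec :: "nat \<Rightarrow> nat \<Rightarrow> 'a set \<Rightarrow> bool"
    assume A: "A \<in> copies R E"
      and dense: "\<And>n B. B \<in> copies R E \<Longrightarrow> B \<subseteq> A \<Longrightarrow> \<exists>C\<in>copies R E. C \<subseteq> B \<and> (\<exists>m. dec n m C)"
      and mono: "\<And>n m B C. dec n m B \<Longrightarrow> C \<in> copies R E \<Longrightarrow> C \<subseteq> B \<Longrightarrow> dec n m C"
    have sub: "B \<in> copies R E \<longleftrightarrow> rado_graph B E" if "B \<subseteq> A" for B
      using that A copy by blast
    \<comment> \<open>The conjunct \<open>B \<subseteq> A\<close> keeps \<open>mono\<close>
      applicable: it places every smaller Rado graph inside \<open>R\<close>, and so among the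
      conditions.\<close>
    define dec' where "dec' n m B \<longleftrightarrow> B \<subseteq> A \<and> dec n m B" for n m B
    have "\<exists>B\<subseteq>A. rado_graph B E \<and> (\<exists>T. binary_subtree T \<and>
      (\<forall>n C. rado_graph C E \<longrightarrow> C \<subseteq> B \<longrightarrow>
        (\<exists>D\<subseteq>C. rado_graph D E \<and> (\<exists>t\<in>T. length t = n \<and> (\<forall>k<n. dec' k (t ! k) D)))))"
    proof (rule rado_two_localization)
      show "rado_graph A E" using A copy by blast
      fix n B assume B: "rado_graph B E" "B \<subseteq> A"
      then obtain C m where C: "C \<in> copies R E" "C \<subseteq> B" "dec n m C" using dense sub by meson
      then have "rado_graph C E" "dec' n m C" using B(2) copy unfolding dec'_def by blast+
      with C(2) show "\<exists>C\<subseteq>B. rado_graph C E \<and> (\<exists>m. dec' n m C)" by blast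
    next
      fix n m B C assume "dec' n m B" "C \<subseteq> B" "rado_graph C E"
      then show "dec' n m C" using mono[of n m B C] sub[of C] unfolding dec'_def by blast
    qed
    then obtain B T where B: "B \<subseteq> A" "rado_graph B E" "binary_subtree T"
      and read: "\<And>n C. rado_graph C E \<Longrightarrow> C \<subseteq> B \<Longrightarrow>
        \<exists>D\<subseteq>C. rado_graph D E \<and> (\<exists>t\<in>T. length t = n \<and> (\<forall>k<n. dec' k (t ! k) D))" by meson
    have "\<exists>D\<in>copies R E. D \<subseteq> C \<and> (\<exists>t\<in>T. length t = n \<and> (\<forall>k<n. dec k (t ! k) D))"
      if C: "C \<in> copies R E" "C \<subseteq> B" for n C
    proof -
      obtain D t where D: "D \<subseteq> C" "rado_graph D E" "t \<in> T" "length t = n" "\<forall>k<n. dec' k (t ! k) D"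
        using read[OF _ C(2), of n] C(1) copy by blast
      then have "D \<in> copies R E" using C(1) copy by blast
      with D show ?thesis unfolding dec'_def by blast
    qed
    then show "\<exists>B\<in>copies R E. B \<subseteq> A \<and> (\<exists>T. binary_subtree T \<and> (\<forall>n. \<forall>C\<in>copies R E. C \<subseteq> B \<longrightarrow>
        (\<exists>D\<in>copies R E. D \<subseteq> C \<and> (\<exists>t\<in>T. length t = n \<and> (\<forall>k<n. dec k (t ! k) D)))))"
      using B sub by (intro bexI[of _ B] conjI exI[of _ T]) blast+
  qed
qed

end
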